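(* Let $B=(b_{i,j})\in M_2(\mathbb{R})$ have nonnegative entries and let $\alpha=\sqrt{b_{1,1}}$, $\beta=\sqrt{b_{1,2}}$, $\gamma=\sqrt{b_{2,1}}$, $\delta=\sqrt{b_{2,2}}$. For $i,j\in\{1,2\}$ let $\mu_{i,j}$ be the probability measure on $\mathbb{R}$ with K-transform $K_{i,j}$ associated with $B$. If $\alpha,\beta,\gamma,\delta\neq0$, then $$\mu_{1,1}=T_{1/t}(\sigma_{\alpha,\beta}\mathbin{\boxed{\vdash}}\sigma_{\delta,\gamma}),\qquad \mu_{2,2}=T_{1/s}(\sigma_{\delta,\gamma}\mathbin{\boxed{\vdash}}\sigma_{\alpha,\beta}),$$ and the non-diagonal measures are given by $\mu_{1,2}=T_t\mu_{1,1}$ and $\mu_{2,1}=T_s\mu_{2,2}$, where $t=(\beta/\alpha)^2$ and $s=(\gamma/\delta)^2$.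
   Context: For a probability measure $\mu$ on $\mathbb{R}$ with Cauchy transform $G_\mu$, let $F_\mu=1/G_\mu$ and $K_\mu(z)=z-F_\mu(z)$ (the K-transform), $z\in\mathbb{C}^+$. For $B=(b_{i,j})\in M_r(\mathbb{R})$ with nonnegative entries, put $K^{(0)}_{i,j}(z)=b_{i,j}/z$ and $K^{(m)}_{i,j}(z)=b_{i,j}/(z-\sum_{p=1}^r K^{(m-1)}_{p,i}(z))$ for $m\ge1$; $K_{i,j}=\lim_m K^{(m)}_{i,j}$ (locally uniformly on $\mathbb{C}^+$) is the continued fraction $\cfrac{b_{i,j}}{z-\sum_k\cfrac{b_{k,i}}{z-\sum_p\cfrac{b_{p,k}}{z-\cdots}}}$, and it is the K-transform of a compactly supported probability measure $\mu_{i,j}$. Monotone convolution $\mu\vartriangleright\nu$: $F_{\mu\vartriangleright\nu}=F_\mu\circ F_\nu$. $\boxplus$ denotes free additive convolution. The s-free additive convolution $\mu\mathbin{\boxed{\vdash}}\nu$ is the unique probability measure on $\mathbb{R}$ with $\nu\boxplus\mu=\nu\vartriangleright(\mu\mathbin{\boxed{\vdash}}\nu)$. Boolean compression: for $t\ge0$, $T_t\mu$ is the unique probability measure with $K_{T_t\mu}=tK_\mu$. For $\alpha>0$, $\sigma_\alpha$ is the Wigner semicircle distribution with Cauchy transform $G_{\sigma_\alpha}(z)=\frac{z-\sqrt{z^2-4\alpha^2}}{2\alpha^2}$ (variance $\alpha^2$; branch positive for real $z>2\alpha$). For $\alpha,\beta>0$, $\sigma_{\alpha,\beta}=T_t\sigma_\alpha$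 with $t=(\beta/\alpha)^2$. *)

theory Defs
  imports "HOL-Probability.Probability" "HOL-Complex_Analysis.Complex_Analysis"
begin

text \<open>
  Probability measures on the real line are Borel measures satisfying \<^locale>\<open>real_distribution\<close>.
  The transforms below are of interest on the open upper half-plane only, and identities
  between them are required only there. A measure on the real line is determined by its Cauchy
  transform on the upper half-plane, so measures introduced by a transform are given by definite
  description.
\<close>

definition cauchy_transform :: "real measure \<Rightarrow> complex \<Rightarrow> complex" where
  "cauchy_transform \<mu> z = (CLINT x|\<mu>. 1 / (z - complex_of_real x))"

definition F_transform :: "real measure \<Rightarrow> complex \<Rightarrow> complex" where
  "F_transform \<mu> z = 1 / cauchy_transform \<mu> z"

definition K_transform :: "real measure \<Rightarrow> complex \<Rightarrow> complex" where
  "K_transform \<mu> z = z - F_transform \<mu> z"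


definition monotone_conv :: "real measure \<Rightarrow> real measure \<Rightarrow> real measure" where
  "monotone_conv \<mu> \<nu> = (THE \<rho>. real_distribution \<rho> \<and>
     (\<forall>z. Im z > 0 \<longrightarrow> F_transform \<rho> z = F_transform \<mu> (F_transform \<nu> z)))"

definition boolean_compression :: "real \<Rightarrow> real measure \<Rightarrow> real measure" where
  "boolean_compression t \<mu> = (THE \<rho>. real_distribution \<rho> \<and>
     (\<forall>z. Im z > 0 \<longrightarrow> K_transform \<rho> z = complex_of_real t * K_transform \<mu> z))"


definition truncated_cone :: "real \<Rightarrow> real \<Rightarrow> complex set" where
  "truncated_cone a M = {z. M < Im z \<and> \<bar>Re z\<bar> < a * Im z}"

text \<open>
  The Voiculescu transform is \<open>\<phi>(z) = F\<^sup>-\<^sup>1(z) - z\<close>, where \<open>F\<^sup>-\<^sup>1\<close> is the right inverse of the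
  F-transform of \<open>\<mu>\<close> on some truncated cone with \<open>F\<^sup>-\<^sup>1(z) = z (1 + o(1))\<close> as \<open>z\<close> tends to infinity
  in the cone. The F-transform need not be injective on the whole upper half-plane; the asymptotic
  condition selects the branch, as the F-transform is injective on truncated cones that are
  sufficiently far up. Free additive convolution is characterized by additivity of this transform,
  which requires no moment or support condition on the measures.
\<close>

definition voiculescu_transform_on ::
    "real measure \<Rightarrow> complex set \<Rightarrow> (complex \<Rightarrow> complex) \<Rightarrow> bool" where
  "voiculescu_transform_on \<mu> \<Gamma> \<phi> \<longleftrightarrow>
     \<phi> holomorphic_on \<Gamma> \<and>
     (\<forall>z\<in>\<Gamma>. Im (z + \<phi> z) > 0 \<and> F_transform \<mu> (z + \<phi> z) = z) \<and>
     ((\<lambda>z. \<phi> z / z) \<longlongrightarrow> 0) (inf at_infinity (principal \<Gamma>))"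

definition free_conv :: "real measure \<Rightarrow> real measure \<Rightarrow> real measure" where
  "free_conv \<mu> \<nu> = (THE \<rho>. real_distribution \<rho> \<and>
     (\<exists>a>0. \<exists>M>0. \<exists>\<phi> \<psi>.
        voiculescu_transform_on \<mu> (truncated_cone a M) \<phi> \<and>
        voiculescu_transform_on \<nu> (truncated_cone a M) \<psi> \<and>
        voiculescu_transform_on \<rho> (truncated_cone a M) (\<lambda>z. \<phi> z + \<psi> z)))"

definition s_free_conv :: "real measure \<Rightarrow> real measure \<Rightarrow> real measure" where
  "s_free_conv \<mu> \<nu> = (THE \<rho>. real_distribution \<rho> \<and> free_conv \<nu> \<mu> = monotone_conv \<nu> \<rho>)"


text \<open>
  The square root of \<open>z\<^sup>2 - 4\<alpha>\<^sup>2\<close> is written as a product of two principal square roots: this is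
  the branch analytic on the upper half-plane whose continuation to real \<open>z > 2\<alpha>\<close> is positive.
  The principal root of \<open>z\<^sup>2 - 4\<alpha>\<^sup>2\<close> itself has the wrong sign when \<open>Re z < 0\<close>.
\<close>

definition semicircle :: "real \<Rightarrow> real measure" where
  "semicircle \<alpha> = (THE \<rho>. real_distribution \<rho> \<and>
     (\<forall>z. Im z > 0 \<longrightarrow> cauchy_transform \<rho> z =
        (z - csqrt (z - complex_of_real (2 * \<alpha>)) * csqrt (z + complex_of_real (2 * \<alpha>)))
          / complex_of_real (2 * \<alpha>\<^sup>2)))"

definition semicircle2 :: "real \<Rightarrow> real \<Rightarrow> real measure" where
  "semicircle2 \<alpha> \<beta> = boolean_compression ((\<beta> / \<alpha>)\<^sup>2) (semicircle \<alpha>)"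


primrec K_approx :: "real^'r^'r \<Rightarrow> nat \<Rightarrow> 'r \<Rightarrow> 'r \<Rightarrow> complex \<Rightarrow> complex" where
  "K_approx B 0 i j z = complex_of_real (B $ i $ j) / z"
| "K_approx B (Suc m) i j z =
     complex_of_real (B $ i $ j) / (z - (\<Sum>p\<in>UNIV. K_approx B m p i z))"

text \<open>
  The pointwise limit suffices to determine the function: for nonnegative entries the
  approximants converge locally uniformly on the upper half-plane.
\<close>

definition K_fraction :: "real^'r^'r \<Rightarrow> 'r \<Rightarrow> 'r \<Rightarrow> complex \<Rightarrow> complex" where
  "K_fraction B i j z = lim (\<lambda>m. K_approx B m i j z)"

definition fraction_measure :: "real^'r^'r \<Rightarrow> 'r \<Rightarrow> 'r \<Rightarrow> real measure" where
  "fraction_measure B i j = (THE \<rho>. real_distribution \<rho> \<and>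
     (\<forall>z. Im z > 0 \<longrightarrow> K_transform \<rho> z = K_fraction B i j z))"

end

theory Submission
  imports Defs
begin

text \<open>
  Put \<open>A = K\<^sub>1\<^sub>2\<close> and \<open>C = K\<^sub>2\<^sub>1\<close>. The rows of the continued fraction are proportional, so that the fixed
  point equations reduce to \<open>A (z - A/t - C) = \<beta>\<^sup>2\<close> and \<open>C (z - A - C/s) = \<gamma>\<^sup>2\<close>. The measures
  \<open>\<mu> = \<sigma>\<^sub>\<alpha>\<^sub>\<beta>\<close> and \<open>\<nu> = \<sigma>\<^sub>\<delta>\<^sub>\<gamma>\<close> satisfy the corresponding equations \<open>K\<^sub>\<mu> (z - K\<^sub>\<mu>/t) = \<beta>\<^sup>2\<close> and
  \<open>K\<^sub>\<nu> (z - K\<^sub>\<nu>/s) = \<gamma>\<^sup>2\<close>, hence \<open>A = K\<^sub>\<mu> (z - C)\<close> and \<open>C = K\<^sub>\<nu> (z - A)\<close>. With \<open>w = z - A - C\<close> this says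
  \<open>F\<^sub>\<mu> (w + A) = w = F\<^sub>\<nu> (w + C)\<close>, so \<open>A\<close> and \<open>C\<close> are the Voiculescu transforms at \<open>w\<close> and
  \<open>z - A - C\<close> is the F-transform of \<open>\<nu> \<boxplus> \<mu>\<close>; it is also \<open>F\<^sub>\<nu> (z - A)\<close>, so \<open>A\<close> is the K-transform of
  the s-free convolution.

  All the measures are definite descriptions. Uniqueness comes from Stieltjes inversion, existence
  from Nevanlinna's theorem: every holomorphic map of the upper half-plane into the closed lower one
  which is \<open>o(y)\<close> along the imaginary axis is a K-transform.
\<close>

subsection \<open>The Cauchy transform on the upper half-plane\<close>

text \<open>The obstacle is the choice of roots. The equations for the K-transforms and for the pair
  \<open>A\<close>, \<open>C\<close> are quadratic and F-transforms need not be injective, so the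
  algebra alone does not give \<open>A = K_\<mu> (z - C)\<close>. Two sign arguments replace a
  discussion of branches. The roots \<open>k\<close> of \<open>k (\<zeta> - k / s) = c\<close> have
  sum \<open>s \<zeta>\<close>, which lies in the upper half-plane, so at most one of them has
  nonpositive imaginary part. For the pair, a solution with both imaginary parts nonpositive is a
  fixed point of the continued fraction map, and a hyperbolic contraction makes such a fixed point
  unique at each single \<open>z\<close>. This pointwise uniqueness allows arbitrary right inverses
  \<open>\<phi>\<close>, \<open>\<psi>\<close> on an arbitrary cone to be compared with
  \<open>A\<close> and \<open>C\<close>, as the definite description of \<open>free_conv\<close>
  demands. The same contraction makes the approximants converge. Free convolution is not constructed
  in general: the candidate is a monotone convolution, which exists by Nevanlinna's theorem.\<close>

abbreviation upper :: "complex set" where "upper \<equiv> {z. 0 < Im z}"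

lemma open_upper: "open upper"
  by (rule open_halfspace_Im_gt)

lemma convex_upper: "convex upper"
  by (rule convex_halfspace_Im_gt)

lemma connected_upper: "connected upper"
  by (rule convex_connected[OF convex_upper])

lemma Im_le_norm_diff_real:
  "Im z \<le> norm (z - complex_of_real x)"
  by (metis abs_Im_le_cmod abs_le_D1 Im_complex_of_real diff_zero minus_complex.simps(2))

lemma diff_real_nonzero:
  "0 < Im z \<Longrightarrow> z - complex_of_real x \<noteq> 0"
  "0 < Im z \<Longrightarrow> z \<noteq> complex_of_real x"
  using Im_le_norm_diff_real[of z x] by auto

lemma norm_cauchy_kernel_le:
  assumes "0 < Im z"
  shows "norm (1 / (z - complex_of_real x)) \<le> 1 / Im z"
  using assms Im_le_norm_diff_real[of z x] by (simp add: norm_divide frac_le)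

context real_distribution
begin

lemma integrable_bounded:
  fixes f :: "real \<Rightarrow> 'b::{banach, second_countable_topology}"
  assumes "f \<in> borel_measurable borel" "\<And>x. norm (f x) \<le> B"
  shows "integrable M f"
  using assms by (intro integrable_const_bound[of _ B]) auto

lemma integrable_cauchy_kernel:
  "0 < Im z \<Longrightarrow> integrable M (\<lambda>x. 1 / (z - complex_of_real x))"
  by (rule integrable_bounded[OF _ norm_cauchy_kernel_le]) auto

lemma Im_cauchy_kernel:
  assumes "0 < Im z"
  shows "Im (1 / (z - complex_of_real x)) = - Im z * (norm (1 / (z - complex_of_real x)))\<^sup>2"
  by (simp add: Im_divide norm_divide cmod_power2 power_divide)

lemma integrable_norm_cauchy_kernel_sq:
  assumes "0 < Im z"
  shows "integrable M (\<lambda>x. (norm (1 / (z - complex_of_real x)))\<^sup>2)"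
  by (rule integrable_bounded[of _ "(1 / Im z)\<^sup>2"])
     (use norm_cauchy_kernel_le[OF assms] in \<open>auto intro!: power_mono\<close>)

lemma Im_cauchy_transform:
  assumes "0 < Im z"
  shows "Im (cauchy_transform M z) = - Im z * (LINT x|M. (norm (1 / (z - complex_of_real x)))\<^sup>2)"
proof -
  have "Im (cauchy_transform M z) = (LINT x|M. Im (1 / (z - complex_of_real x)))"
    unfolding cauchy_transform_def using integrable_cauchy_kernel[OF assms] by simp
  also have "\<dots> = - Im z * (LINT x|M. (norm (1 / (z - complex_of_real x)))\<^sup>2)"
    unfolding Im_cauchy_kernel[OF assms] by simp
  finally show ?thesis .
qed

text \<open>The triangle inequality reduces this to the modulus of the kernel, whose variance is
  nonnegative.\<close>

lemma norm_cauchy_transform_sq_le: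
  assumes "0 < Im z"
  shows "(norm (cauchy_transform M z))\<^sup>2 \<le> (LINT x|M. (norm (1 / (z - complex_of_real x)))\<^sup>2)"
proof -
  let ?f = "\<lambda>x. norm (1 / (z - complex_of_real x))"
  have "norm (cauchy_transform M z) \<le> (LINT x|M. ?f x)"
    unfolding cauchy_transform_def by (rule integral_norm_bound)
  then have "(norm (cauchy_transform M z))\<^sup>2 \<le> (LINT x|M. ?f x)\<^sup>2"
    by (rule power_mono) simp
  also have "\<dots> \<le> (LINT x|M. (?f x)\<^sup>2)"
  proof -
    have "0 \<le> variance ?f" by simp
    then show ?thesis
      using variance_eq[of ?f] integrable_cauchy_kernel[OF assms]
        integrable_norm_cauchy_kernel_sq[OF assms] by (simp add: integrable_norm)
  qed
  finally show ?thesis .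
qed

lemma Im_cauchy_transform_neg:
  assumes "0 < Im z"
  shows "Im (cauchy_transform M z) < 0"
proof -
  have "0 < (LINT x|M. (norm (1 / (z - complex_of_real x)))\<^sup>2)"
  proof (rule ccontr)
    assume "\<not> ?thesis"
    then have "(LINT x|M. (norm (1 / (z - complex_of_real x)))\<^sup>2) = 0"
      by (intro antisym integral_nonneg) auto
    then have "AE x in M. (norm (1 / (z - complex_of_real x)))\<^sup>2 = 0"
      by (subst (asm) integral_nonneg_eq_0_iff_AE) (use integrable_norm_cauchy_kernel_sq[OF assms] in auto)
    then have "AE x in M. False"
      by eventually_elim (use diff_real_nonzero[OF assms] in auto)
    then show False by simp
  qed
  then show ?thesis
    using assms by (simp add: Im_cauchy_transform)
qed

lemma cauchy_transform_nonzero: "0 < Im z \<Longrightarrow> cauchy_transform M z \<noteq> 0"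
  using Im_cauchy_transform_neg by fastforce

text \<open>As \<open>Im (1 / G) = - Im G / |G|^2\<close>, this is the variance inequality divided
  by \<open>|G|^2\<close>. It puts K in the closed lower half-plane and lets F-transforms be
  composed.\<close>

lemma Im_F_transform_ge:
  assumes "0 < Im z"
  shows "Im z \<le> Im (F_transform M z)"
proof -
  let ?G = "cauchy_transform M z"
  have "Im z * (norm ?G)\<^sup>2 \<le> - Im ?G"
    using norm_cauchy_transform_sq_le[OF assms] assms by (simp add: Im_cauchy_transform)
  moreover have "0 < (norm ?G)\<^sup>2" using cauchy_transform_nonzero[OF assms] by simp
  ultimately show ?thesis
    unfolding F_transform_def by (simp add: Im_divide cmod_power2 field_simps)
qed

lemma Im_K_transform_le: "0 < Im z \<Longrightarrow> Im (K_transform M z) \<le> 0"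
  using Im_F_transform_ge by (simp add: K_transform_def)

lemma cauchy_transform_diff:
  assumes "0 < Im z" "0 < Im w"
  shows "cauchy_transform M w - cauchy_transform M z
    = (z - w) * (LINT x|M. 1 / ((w - complex_of_real x) * (z - complex_of_real x)))"
proof -
  have "cauchy_transform M w - cauchy_transform M z
    = (LINT x|M. 1 / (w - complex_of_real x) - 1 / (z - complex_of_real x))"
    unfolding cauchy_transform_def using assms by (simp add: integrable_cauchy_kernel)
  also have "\<dots> = (LINT x|M. (z - w) * (1 / ((w - complex_of_real x) * (z - complex_of_real x))))"
    by (rule Bochner_Integration.integral_cong)
       (use assms in \<open>simp_all add: diff_frac_eq diff_real_nonzero\<close>)
  also have "\<dots> = (z - w) * (LINT x|M. 1 / ((w - complex_of_real x) * (z - complex_of_real x)))"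
    by (rule integral_mult_right_zero)
  finally show ?thesis .
qed

text \<open>The resolvent identity writes the difference quotient as a single integral, so dominated
  convergence along sequences suffices. Dropping the first \<open>N\<close> terms keeps the sequence
  above height \<open>Im z / 2\<close>, which yields a constant majorant.\<close>

lemma cauchy_transform_has_field_derivative:
  assumes z: "0 < Im z"
  shows "(cauchy_transform M has_field_derivative
    - (LINT x|M. 1 / ((z - complex_of_real x) * (z - complex_of_real x)))) (at z)"
  unfolding has_field_derivative_iff tendsto_at_iff_sequentially comp_def
proof (intro allI impI)
  fix X :: "nat \<Rightarrow> complex"
  assume X: "\<forall>i. X i \<in> UNIV - {z}" "X \<longlonglongrightarrow> z"
  let ?q = "\<lambda>w x. 1 / ((w - complex_of_real x) * (z - complex_of_real x))"
  have "(\<lambda>i. Im (X i)) \<longlonglongrightarrow> Im z" by (intro tendsto_intros X)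
  then have ev: "eventually (\<lambda>i. Im z / 2 < Im (X i)) sequentially"
    using z by (intro order_tendstoD(1)) auto
  then obtain N where N: "\<And>i. N \<le> i \<Longrightarrow> Im z / 2 < Im (X i)"
    by (auto simp: eventually_sequentially)
  have "(\<lambda>i. LINT x|M. ?q (X (i + N)) x) \<longlonglongrightarrow> (LINT x|M. ?q z x)"
  proof (rule integral_dominated_convergence[where w = "\<lambda>_. 1 / (Im z / 2) * (1 / Im z)"])
    show "AE x in M. (\<lambda>i. ?q (X (i + N)) x) \<longlonglongrightarrow> ?q z x"
      by (intro AE_I2 tendsto_intros LIMSEQ_ignore_initial_segment X)
         (use z diff_real_nonzero in auto)
    show "AE x in M. norm (?q (X (i + N)) x) \<le> 1 / (Im z / 2) * (1 / Im z)" for i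
    proof (rule AE_I2)
      fix x
      have *: "Im z / 2 < Im (X (i + N))" using N by simp
      have "norm (?q (X (i + N)) x)
        = norm (1 / (X (i + N) - complex_of_real x)) * norm (1 / (z - complex_of_real x))"
        by (simp add: norm_mult norm_divide)
      also have "\<dots> \<le> 1 / Im (X (i + N)) * (1 / Im z)"
        by (intro mult_mono norm_cauchy_kernel_le) (use z * in auto)
      also have "\<dots> \<le> 1 / (Im z / 2) * (1 / Im z)"
        by (intro mult_right_mono frac_le) (use z * in auto)
      finally show "norm (?q (X (i + N)) x) \<le> 1 / (Im z / 2) * (1 / Im z)" .
    qed
  qed auto
  then have "(\<lambda>i. LINT x|M. ?q (X i) x) \<longlonglongrightarrow> (LINT x|M. ?q z x)"
    by (rule LIMSEQ_offset)
  then have "(\<lambda>i. - (LINT x|M. ?q (X i) x)) \<longlonglongrightarrow> - (LINT x|M. ?q z x)"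
    by (rule tendsto_minus)
  moreover have "eventually (\<lambda>i. - (LINT x|M. ?q (X i) x)
      = (cauchy_transform M (X i) - cauchy_transform M z) / (X i - z)) sequentially"
    using ev
  proof eventually_elim
    case (elim i)
    then have "cauchy_transform M (X i) - cauchy_transform M z
      = (z - X i) * (LINT x|M. ?q (X i) x)"
      using z by (intro cauchy_transform_diff) auto
    then show ?case using X(1) by (simp add: field_simps)
  qed
  ultimately show "(\<lambda>i. (cauchy_transform M (X i) - cauchy_transform M z) / (X i - z))
      \<longlonglongrightarrow> - (LINT x|M. ?q z x)"
    by (rule Lim_transform_eventually)
qed

lemma holomorphic_cauchy_transform: "cauchy_transform M holomorphic_on upper"
  using cauchy_transform_has_field_derivative
  by (auto simp: holomorphic_on_open[OF open_upper])

lemma holomorphic_F_transform: "F_transform M holomorphic_on upper"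
  unfolding F_transform_def
  by (intro holomorphic_intros holomorphic_cauchy_transform) (use cauchy_transform_nonzero in auto)

lemma holomorphic_K_transform: "K_transform M holomorphic_on upper"
  unfolding K_transform_def by (intro holomorphic_intros holomorphic_F_transform)

text \<open>The kernel times \<open>i y\<close> is bounded by 1 and tends to 1 pointwise, so the
  limit is the total mass. Nevanlinna's growth condition on K is this normalisation in another
  form.\<close>

lemma cauchy_transform_vertical_limit:
  "((\<lambda>y. \<i> * complex_of_real y * cauchy_transform M (\<i> * complex_of_real y)) \<longlongrightarrow> 1) at_top"
proof -
  let ?g = "\<lambda>y x. \<i> * complex_of_real y * (1 / (\<i> * complex_of_real y - complex_of_real x))"
  have "((\<lambda>y. LINT x|M. ?g y x) \<longlongrightarrow> (LINT x|M. 1)) at_top"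
  proof (rule integral_dominated_convergence_at_top[where w = "\<lambda>_. 1"])
    show "\<forall>\<^sub>F y in at_top. AE x in M. norm (?g y x) \<le> 1"
      using eventually_gt_at_top[of 0]
    proof eventually_elim
      case (elim y)
      have "norm (?g y x) \<le> 1" for x
      proof -
        have "norm (?g y x) = y * norm (1 / (\<i> * complex_of_real y - complex_of_real x))"
          using elim by (simp add: norm_mult norm_divide)
        also have "\<dots> \<le> y * (1 / y)"
          using norm_cauchy_kernel_le[of "\<i> * complex_of_real y" x] elim
          by (intro mult_left_mono) auto
        finally show ?thesis using elim by simp
      qed
      then show ?case by simp
    qed
    show "AE x in M. ((\<lambda>y. ?g y x) \<longlongrightarrow> 1) at_top"
    proof (rule AE_I2)
      fix x
      have "((\<lambda>y. 1 / (1 + \<i> * complex_of_real (x / y))) \<longlongrightarrow> 1 / (1 + \<i> * complex_of_real 0)) at_top"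
        by (intro tendsto_intros real_tendsto_divide_at_top filterlim_ident) auto
      then have lim: "((\<lambda>y. 1 / (1 + \<i> * complex_of_real (x / y))) \<longlongrightarrow> 1) at_top" by simp
      have "\<forall>\<^sub>F y in at_top. 1 / (1 + \<i> * complex_of_real (x / y)) = ?g y x"
        using eventually_gt_at_top[of 0]
      proof eventually_elim
        case (elim y)
        have "\<i> * complex_of_real y \<noteq> 0" using elim by simp
        moreover have "\<i> * complex_of_real y * (1 + \<i> * complex_of_real (x / y))
           = \<i> * complex_of_real y - complex_of_real x"
          using elim by (simp add: algebra_simps)
        ultimately show ?case
          by (metis mult_divide_mult_cancel_left mult.right_neutral times_divide_eq_right)
      qed
      then show "((\<lambda>y. ?g y x) \<longlongrightarrow> 1) at_top"
        by (rule Lim_transform_eventually[OF lim])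
    qed
  qed auto
  then show ?thesis
    using prob_space unfolding cauchy_transform_def integral_mult_right_zero by simp
qed

lemma K_transform_vertical_limit:
  "((\<lambda>y. K_transform M (\<i> * complex_of_real y) / complex_of_real y) \<longlongrightarrow> 0) at_top"
proof -
  have "((\<lambda>y. \<i> * (1 - 1 / (\<i> * complex_of_real y * cauchy_transform M (\<i> * complex_of_real y)))) \<longlongrightarrow> \<i> * (1 - 1 / 1)) at_top"
    by (intro tendsto_intros cauchy_transform_vertical_limit) auto
  then have lim: "((\<lambda>y. \<i> * (1 - 1 / (\<i> * complex_of_real y * cauchy_transform M (\<i> * complex_of_real y)))) \<longlongrightarrow> 0) at_top"
    by simp
  show ?thesis
  proof (rule Lim_transform_eventually[OF lim])
    show "\<forall>\<^sub>F y in at_top. \<i> * (1 - 1 / (\<i> * complex_of_real y * cauchy_transform M (\<i> * complex_of_real y)))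
       = K_transform M (\<i> * complex_of_real y) / complex_of_real y"
      using eventually_gt_at_top[of 0]
    proof eventually_elim
      case (elim y)
      then show ?case
        using cauchy_transform_nonzero[of "\<i> * complex_of_real y"]
        by (simp add: K_transform_def F_transform_def field_simps)
    qed
  qed
qed

end

subsection \<open>Stieltjes inversion\<close>

context real_distribution
begin

text \<open>The negative imaginary part of the kernel is the Poisson kernel up to the factor pi,
  with an arctangent as antiderivative in \<open>x\<close>. Working with nonnegative integrals,
  Tonelli's theorem exchanges the order.\<close>

lemma nn_integral_Im_cauchy_transform:
  assumes y: "0 < y" and ab: "a \<le> b"
  shows "(\<integral>\<^sup>+x. ennreal (- Im (cauchy_transform M (Complex x y))) * indicator {a..b} x \<partial>lborel)
    = ennreal (LINT t|M. arctan ((b - t) / y) - arctan ((a - t) / y))"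
proof -
  let ?k = "\<lambda>x t. y / ((x - t)\<^sup>2 + y\<^sup>2)"
  interpret P: pair_sigma_finite lborel M
    by (intro pair_sigma_finite.intro lborel.sigma_finite_measure_axioms sigma_finite_measure_axioms)
  have eq: "?k x t = - Im (1 / (Complex x y - complex_of_real t))" for x t
    by (simp add: Im_divide)
  have "ennreal (- Im (cauchy_transform M (Complex x y))) = (\<integral>\<^sup>+t. ennreal (?k x t) \<partial>M)" for x
  proof -
    have int: "integrable M (\<lambda>t. 1 / (Complex x y - complex_of_real t))"
      by (rule integrable_cauchy_kernel) (use y in simp)
    have "- Im (cauchy_transform M (Complex x y)) = (LINT t|M. ?k x t)"
      unfolding cauchy_transform_def eq using int by simp
    moreover have "integrable M (\<lambda>t. ?k x t)" unfolding eq using int by simp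
    ultimately show ?thesis
      using y by (simp add: nn_integral_eq_integral)
  qed
  then have "(\<integral>\<^sup>+x. ennreal (- Im (cauchy_transform M (Complex x y))) * indicator {a..b} x \<partial>lborel)
     = (\<integral>\<^sup>+x. (\<integral>\<^sup>+t. ennreal (?k x t) * indicator {a..b} x \<partial>M) \<partial>lborel)"
    by (simp add: nn_integral_multc)
  also have "\<dots> = (\<integral>\<^sup>+t. (\<integral>\<^sup>+x. ennreal (?k x t) * indicator {a..b} x \<partial>lborel) \<partial>M)"
    by (rule P.Fubini'[symmetric]) measurable
  also have "\<dots> = (\<integral>\<^sup>+t. ennreal (arctan ((b - t) / y) - arctan ((a - t) / y)) \<partial>M)"
  proof (rule nn_integral_cong)
    fix t
    show "(\<integral>\<^sup>+x. ennreal (?k x t) * indicator {a..b} x \<partial>lborel)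
      = ennreal (arctan ((b - t) / y) - arctan ((a - t) / y))"
    proof (rule nn_integral_FTC_Icc[OF _ _ _ ab])
      fix x
      have "((\<lambda>x. arctan ((x - t) / y)) has_real_derivative
         inverse (1 + ((x - t) / y)\<^sup>2) * (1 / y)) (at x)"
        by (rule DERIV_chain2[OF DERIV_arctan]) (use y in \<open>auto intro!: derivative_eq_intros\<close>)
      also have "inverse (1 + ((x - t) / y)\<^sup>2) * (1 / y) = ?k x t"
      proof -
        have "1 + ((x - t) / y)\<^sup>2 = ((x - t)\<^sup>2 + y\<^sup>2) / y\<^sup>2"
          using y by (simp add: field_simps power_divide)
        then show ?thesis using y by (simp add: power2_eq_square)
      qed
      finally show "((\<lambda>x. arctan ((x - t) / y)) has_real_derivative ?k x t) (at x)" .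
    qed (use y in auto)
  qed
  also have "\<dots> = ennreal (LINT t|M. arctan ((b - t) / y) - arctan ((a - t) / y))"
  proof (rule nn_integral_eq_integral)
    have "\<bar>arctan u - arctan v\<bar> \<le> pi" for u v
      using arctan_bounded[of u] arctan_bounded[of v] by linarith
    then show "integrable M (\<lambda>t. arctan ((b - t) / y) - arctan ((a - t) / y))"
      by (intro integrable_bounded[of _ pi]) auto
    show "AE t in M. 0 \<le> arctan ((b - t) / y) - arctan ((a - t) / y)"
      using y ab by (auto simp: divide_right_mono arctan_le_iff intro!: AE_I2)
  qed
  finally show ?thesis .
qed

text \<open>Pushing the left endpoint to minus infinity isolates the arctangent integral at
  \<open>b\<close>, so that it can be compared between two measures.\<close>

lemma integral_arctan_diff_tendsto:
  assumes y: "0 < y"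
  shows "(\<lambda>n. LINT t|M. arctan ((b - t) / y) - arctan ((- real n - t) / y))
     \<longlonglongrightarrow> (LINT t|M. arctan ((b - t) / y)) + pi / 2"
proof -
  have "\<bar>arctan u\<bar> \<le> pi" for u
    using arctan_bounded[of u] by linarith
  then have int: "integrable M (\<lambda>t. arctan ((b - t) / y))"
    by (intro integrable_bounded[of _ pi]) auto
  have "(\<lambda>n. LINT t|M. arctan ((b - t) / y) - arctan ((- real n - t) / y))
     \<longlonglongrightarrow> (LINT t|M. arctan ((b - t) / y) - (- (pi / 2)))"
  proof (rule integral_dominated_convergence[where w = "\<lambda>_. pi"])
    have "\<bar>arctan u - arctan v\<bar> \<le> pi" for u v
      using arctan_bounded[of u] arctan_bounded[of v] by linarith
    then show "AE t in M. norm (arctan ((b - t) / y) - arctan ((- real n - t) / y)) \<le> pi" for n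
      by auto
    show "AE t in M. (\<lambda>n. arctan ((b - t) / y) - arctan ((- real n - t) / y))
       \<longlonglongrightarrow> arctan ((b - t) / y) - (- (pi / 2))"
    proof (intro AE_I2 tendsto_diff tendsto_const)
      fix t
      have "filterlim (\<lambda>n. (- real n - t) / y) at_bot sequentially"
        using y by real_asymp
      then show "(\<lambda>n. arctan ((- real n - t) / y)) \<longlonglongrightarrow> - (pi / 2)"
        by (rule filterlim_compose[OF tendsto_arctan_at_bot])
    qed
  qed auto
  then show ?thesis using int prob_space by simp
qed

text \<open>The integrand tends to pi/2, 0 or -pi/2 according as \<open>t\<close> is left of, at, or
  right of \<open>b\<close>. An atom at \<open>b\<close> is thus counted by half, which gives the
  mean of the distribution function and its left limit.\<close>

lemma integral_arctan_tendsto_cdf: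
  "(\<lambda>k. LINT t|M. arctan ((b - t) / (1 / real (Suc k))))
     \<longlonglongrightarrow> pi / 2 * (cdf M b + measure M {..<b} - 1)"
proof -
  have "(\<lambda>k. LINT t|M. arctan ((b - t) / (1 / real (Suc k))))
     \<longlonglongrightarrow> (LINT t|M. pi / 2 * (indicator {..b} t + indicator {..<b} t - 1))"
  proof (rule integral_dominated_convergence[where w = "\<lambda>_. pi"])
    have "\<bar>arctan u\<bar> \<le> pi" for u
      using arctan_bounded[of u] by linarith
    then show "AE t in M. norm (arctan ((b - t) / (1 / real (Suc k)))) \<le> pi" for k
      by auto
    show "AE t in M. (\<lambda>k. arctan ((b - t) / (1 / real (Suc k))))
       \<longlonglongrightarrow> pi / 2 * (indicator {..b} t + indicator {..<b} t - 1)"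
    proof (rule AE_I2)
      fix t
      consider "t < b" | "t = b" | "b < t" by linarith
      then show "(\<lambda>k. arctan ((b - t) / (1 / real (Suc k))))
         \<longlonglongrightarrow> pi / 2 * (indicator {..b} t + indicator {..<b} t - 1)"
      proof cases
        case 1
        then have "0 < b - t" by simp
        then have "filterlim (\<lambda>k. (b - t) / (1 / real (Suc k))) at_top sequentially"
          by real_asymp
        then show ?thesis
          using filterlim_compose[OF tendsto_arctan_at_top] 1 by simp
      next
        case 2
        then show ?thesis by simp
      next
        case 3
        then have "b - t < 0" by simp
        then have "filterlim (\<lambda>k. (b - t) / (1 / real (Suc k))) at_bot sequentially"
          by real_asymp
        then show ?thesis
          using filterlim_compose[OF tendsto_arctan_at_bot] 3 by simp
      qed
    qed
  qed auto
  then show ?thesis using prob_space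
    by (simp add: cdf_def emeasure_eq_measure)
qed

text \<open>Undoes the averaging at atoms: for \<open>c > b\<close> the mass of the open half-line
  up to \<open>c\<close> lies between the distribution function at \<open>b\<close> and at
  \<open>c\<close>, and right continuity closes the gap.\<close>

lemma cdf_add_left_limit_tendsto:
  "((\<lambda>c. cdf M c + measure M {..<c}) \<longlongrightarrow> 2 * cdf M b) (at_right b)"
proof -
  have lim: "(cdf M \<longlongrightarrow> cdf M b) (at_right b)"
    using cdf_is_right_cont[of b] by (simp add: continuous_within)
  have "((\<lambda>c. measure M {..<c}) \<longlongrightarrow> cdf M b) (at_right b)"
  proof (rule tendsto_sandwich[OF _ _ tendsto_const lim])
    show "\<forall>\<^sub>F c in at_right b. cdf M b \<le> measure M {..<c}"
      unfolding cdf_def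
      by (rule eventually_at_rightI[of b "b + 1"]) (auto intro!: finite_measure_mono)
    show "\<forall>\<^sub>F c in at_right b. measure M {..<c} \<le> cdf M c"
      unfolding cdf_def
      by (intro always_eventually allI finite_measure_mono) auto
  qed
  from tendsto_add[OF lim this] show ?thesis by simp
qed

end

text \<open>Stieltjes inversion: integrating \<open>Im G\<close> along a horizontal line and letting the line approach
  the real axis recovers the distribution function, up to the averaging at atoms.\<close>

theorem cauchy_transform_unique:
  assumes "real_distribution M" "real_distribution N"
    and eq: "\<And>z. 0 < Im z \<Longrightarrow> cauchy_transform M z = cauchy_transform N z"
  shows "M = N"
proof -
  interpret M: real_distribution M by fact
  interpret N: real_distribution N by fact
  have diff_eq: "(LINT t|M. arctan ((b - t) / y) - arctan ((a - t) / y))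
      = (LINT t|N. arctan ((b - t) / y) - arctan ((a - t) / y))" if "0 < y" "a \<le> b" for y a b
  proof -
    have "0 \<le> arctan ((b - t) / y) - arctan ((a - t) / y)" for t
      using that by (simp add: divide_right_mono arctan_le_iff)
    then have nn: "0 \<le> (LINT t|L. arctan ((b - t) / y) - arctan ((a - t) / y))" for L
      by (intro Bochner_Integration.integral_nonneg) auto
    have "ennreal (LINT t|M. arctan ((b - t) / y) - arctan ((a - t) / y))
      = ennreal (LINT t|N. arctan ((b - t) / y) - arctan ((a - t) / y))"
      using M.nn_integral_Im_cauchy_transform[OF that] N.nn_integral_Im_cauchy_transform[OF that]
        that by (simp add: eq)
    then show ?thesis using nn by (simp add: ennreal_inj)
  qed
  have arctan_eq: "(LINT t|M. arctan ((b - t) / y)) = (LINT t|N. arctan ((b - t) / y))"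
    if y: "0 < y" for b y
  proof -
    have "eventually (\<lambda>n. - b \<le> real n) sequentially"
      by (rule eventually_sequentiallyI[of "nat \<lceil>- b\<rceil>"]) linarith
    then have "eventually (\<lambda>n. (LINT t|M. arctan ((b - t) / y) - arctan ((- real n - t) / y))
       = (LINT t|N. arctan ((b - t) / y) - arctan ((- real n - t) / y))) sequentially"
      by eventually_elim (intro diff_eq, use y in auto)
    from Lim_transform_eventually[OF M.integral_arctan_diff_tendsto[OF y] this]
    show ?thesis
      using LIMSEQ_unique[OF _ N.integral_arctan_diff_tendsto[OF y]] by fastforce
  qed
  have "cdf M b + measure M {..<b} = cdf N b + measure N {..<b}" for b
  proof -
    have "pi / 2 * (cdf M b + measure M {..<b} - 1) = pi / 2 * (cdf N b + measure N {..<b} - 1)"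
    proof (rule LIMSEQ_unique[OF M.integral_arctan_tendsto_cdf])
      have "(LINT t|M. arctan ((b - t) / (1 / real (Suc k))))
          = (LINT t|N. arctan ((b - t) / (1 / real (Suc k))))" for k
        by (rule arctan_eq) simp
      then show "(\<lambda>k. LINT t|M. arctan ((b - t) / (1 / real (Suc k))))
         \<longlonglongrightarrow> pi / 2 * (cdf N b + measure N {..<b} - 1)"
        using N.integral_arctan_tendsto_cdf[of b] by presburger
    qed
    then show ?thesis by simp
  qed
  then have "cdf M b = cdf N b" for b
    using tendsto_unique[OF _ M.cdf_add_left_limit_tendsto[of b], of "2 * cdf N b"]
      N.cdf_add_left_limit_tendsto[of b] by simp
  then show ?thesis
    using assms by (intro cdf_unique ext) auto
qed

lemma K_transform_unique:
  assumes "real_distribution M" "real_distribution N"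
    and eq: "\<And>z. 0 < Im z \<Longrightarrow> K_transform M z = K_transform N z"
  shows "M = N"
proof (rule cauchy_transform_unique[OF assms(1,2)])
  fix z :: complex assume "0 < Im z"
  from eq[OF this] show "cauchy_transform M z = cauchy_transform N z"
    by (simp add: K_transform_def F_transform_def)
qed

subsection \<open>Nevanlinna's theorem\<close>

text \<open>The other three sides have lengths \<open>r\<close>, \<open>2 r\<close>,
  \<open>r\<close>, and every point on them has modulus at least \<open>r\<close>.\<close>

lemma norm_rectpath_integral_minus_bottom_le:
  assumes r: "0 < r"
    and cont: "continuous_on (path_image (rectpath (complex_of_real (- r)) (Complex r r))) g"
    and bound: "\<And>w. 0 \<le> Im w \<Longrightarrow> r \<le> norm w \<Longrightarrow> norm (g w) \<le> c"
  shows "norm (contour_integral (rectpath (complex_of_real (- r)) (Complex r r)) g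
      - (LINT x:{- r..r}|lborel. g (complex_of_real x))) \<le> 4 * r * c"
proof -
  define a1 a2 a3 a4 where a: "a1 = complex_of_real (- r)" "a2 = complex_of_real r"
    "a3 = Complex r r" "a4 = Complex (- r) r"
  have rp: "rectpath a1 a3 = linepath a1 a2 +++ linepath a2 a3 +++ linepath a3 a4 +++ linepath a4 a1"
    unfolding rectpath_def Let_def a by (simp add: complex_of_real_def)
  have img: "path_image (rectpath a1 a3) = closed_segment a1 a2 \<union> closed_segment a2 a3
     \<union> closed_segment a3 a4 \<union> closed_segment a4 a1"
    unfolding rp by (simp add: path_image_join Un_assoc)
  have cont': "continuous_on (closed_segment a1 a2) g" "continuous_on (closed_segment a2 a3) g"
     "continuous_on (closed_segment a3 a4) g" "continuous_on (closed_segment a4 a1) g"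
    using cont unfolding a[symmetric] img by (auto elim: continuous_on_subset)
  have ci: "g contour_integrable_on linepath a1 a2" "g contour_integrable_on linepath a2 a3"
     "g contour_integrable_on linepath a3 a4" "g contour_integrable_on linepath a4 a1"
    by (intro contour_integrable_continuous_linepath cont')+
  have split: "contour_integral (rectpath a1 a3) g
     = contour_integral (linepath a1 a2) g + (contour_integral (linepath a2 a3) g
       + (contour_integral (linepath a3 a4) g + contour_integral (linepath a4 a1) g))"
    unfolding rp using ci by simp
  have bottom: "contour_integral (linepath a1 a2) g = (LINT x:{- r..r}|lborel. g (complex_of_real x))"
  proof -
    have "continuous_on {- r..r} (\<lambda>x. g (complex_of_real x))"
    proof (rule continuous_on_compose2[OF cont'(1)])
      show "complex_of_real ` {- r..r} \<subseteq> closed_segment a1 a2"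
        unfolding a closed_segment_of_real using r
        by (simp add: closed_segment_eq_real_ivl)
    qed (intro continuous_intros)
    then have "(LINT x:{- r..r}|lborel. g (complex_of_real x)) = integral {- r..r} (\<lambda>x. g (complex_of_real x))"
      by (intro set_borel_integral_eq_integral(2) borel_integrable_atLeastAtMost')
    moreover have "contour_integral (linepath a1 a2) g = integral {- r..r} (\<lambda>x. g (complex_of_real x))"
      unfolding a using r by (subst contour_integral_linepath_Reals_eq) auto
    ultimately show ?thesis by simp
  qed
  have c: "0 \<le> c"
    by (rule order_trans[OF norm_ge_zero bound[of a2]]) (use r in \<open>simp_all add: a\<close>)
  have convex_im: "convex {w::complex. 0 \<le> Im w}"
    by (rule convex_halfspace_Im_ge)
  have "closed_segment a2 a3 \<subseteq> {w. r \<le> Re w} \<inter> {w. 0 \<le> Im w}"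
    by (intro closed_segment_subset convex_Int convex_halfspace_Re_ge convex_im) (use r in \<open>auto simp: a\<close>)
  then have "norm (g w) \<le> c" if "w \<in> closed_segment a2 a3" for w
    using that abs_Re_le_cmod[of w] by (intro bound) auto
  then have s2: "norm (contour_integral (linepath a2 a3) g) \<le> c * norm (a3 - a2)"
    by (intro contour_integral_bound_linepath ci c) auto
  have "closed_segment a3 a4 \<subseteq> {w. r \<le> Im w}"
    by (intro closed_segment_subset convex_halfspace_Im_ge) (use r in \<open>auto simp: a\<close>)
  then have "norm (g w) \<le> c" if "w \<in> closed_segment a3 a4" for w
    using that r abs_Im_le_cmod[of w] by (intro bound) auto
  then have s3: "norm (contour_integral (linepath a3 a4) g) \<le> c * norm (a4 - a3)"
    by (intro contour_integral_bound_linepath ci c) auto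
  have "closed_segment a4 a1 \<subseteq> {w. Re w \<le> - r} \<inter> {w. 0 \<le> Im w}"
    by (intro closed_segment_subset convex_Int convex_halfspace_Re_le convex_im) (use r in \<open>auto simp: a\<close>)
  then have "norm (g w) \<le> c" if "w \<in> closed_segment a4 a1" for w
    using that abs_Re_le_cmod[of w] by (intro bound) auto
  then have s4: "norm (contour_integral (linepath a4 a1) g) \<le> c * norm (a1 - a4)"
    by (intro contour_integral_bound_linepath ci c) auto
  have lengths: "norm (a3 - a2) = r" "norm (a4 - a3) = 2 * r" "norm (a1 - a4) = r"
    using r by (simp_all add: a complex_of_real_def complex_diff norm_complex_def real_sqrt_mult)
  have "norm (contour_integral (rectpath a1 a3) g - contour_integral (linepath a1 a2) g)
     \<le> norm (contour_integral (linepath a2 a3) g) + (norm (contour_integral (linepath a3 a4) g)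
       + norm (contour_integral (linepath a4 a1) g))"
    unfolding split
    using norm_triangle_ineq[of "contour_integral (linepath a2 a3) g"
        "contour_integral (linepath a3 a4) g + contour_integral (linepath a4 a1) g"]
      norm_triangle_ineq[of "contour_integral (linepath a3 a4) g" "contour_integral (linepath a4 a1) g"]
    by simp
  also have "\<dots> \<le> c * r + (c * (2 * r) + c * r)"
    using s2 s3 s4 unfolding lengths by simp
  finally show ?thesis
    unfolding bottom by (simp add: a algebra_simps)
qed

text \<open>Because of the decay of \<open>f\<close>, the integrand is of order
  \<open>1 / n^2\<close> on three sides of total length \<open>4 n\<close>, so only the real segment
  survives. The point \<open>z\<close> may lie on either side of the axis, since the Poisson formula
  uses both \<open>z\<close> and its conjugate.\<close>

lemma rectpath_integral_limit:
  assumes lim: "\<And>w. 0 \<le> Im w \<Longrightarrow> R \<le> norm w \<Longrightarrow> norm (f w) \<le> C / norm w"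
    and R: "0 < R"
    and hol: "f holomorphic_on {w. - h < Im w}" and h: "0 < h"
    and z: "Im z \<noteq> 0"
    and I: "\<forall>\<^sub>F n in sequentially. ((\<lambda>w. f w / (w - z)) has_contour_integral I) (rectpath (complex_of_real (- real n)) (Complex (real n) (real n)))"
  shows "(\<lambda>n. LINT x:{- real n..real n}|lborel. f (complex_of_real x) / (complex_of_real x - z)) \<longlonglongrightarrow> I"
proof -
  let ?g = "\<lambda>w. f w / (w - z)"
  let ?J = "\<lambda>n. LINT x:{- real n..real n}|lborel. ?g (complex_of_real x)"
  have "\<forall>\<^sub>F n in sequentially. norm (?J n - I) \<le> 8 * C * inverse (real n)"
    using I eventually_ge_at_top[of "nat \<lceil>R + 2 * norm z\<rceil> + 1"]
  proof eventually_elim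
    case (elim n)
    \<comment> \<open>The last inequality gives \<open>norm (w - z) \<ge> n / 2\<close> whenever
      \<open>norm w \<ge> n\<close>; this is the source of the 2 in
      \<open>2 * C / n^2\<close>.\<close>
    have n: "0 < real n" "R \<le> real n" "2 * norm z < real n"
      using elim(2) R norm_ge_zero[of z] by linarith+
    have C: "0 \<le> C"
    proof -
      have "0 \<le> C / norm (complex_of_real R)"
        by (rule order_trans[OF norm_ge_zero lim]) (use R in auto)
      then show ?thesis using R by (simp add: zero_le_divide_iff)
    qed
    let ?P = "path_image (rectpath (complex_of_real (- real n)) (Complex (real n) (real n)))"
    have box: "?P = cbox (complex_of_real (- real n)) (Complex (real n) (real n))
       - box (complex_of_real (- real n)) (Complex (real n) (real n))"
      by (rule path_image_rectpath_cbox_minus_box) (use n in auto)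
    have "norm (contour_integral (rectpath (complex_of_real (- real n)) (Complex (real n) (real n))) ?g
      - ?J n) \<le> 4 * real n * (2 * C / (real n)\<^sup>2)"
    proof (rule norm_rectpath_integral_minus_bottom_le[OF n(1)])
      have "z \<notin> ?P"
      proof
        assume "z \<in> ?P"
        then have "0 \<le> Im z" "Im z \<le> real n" "\<bar>Re z\<bar> \<le> real n" "\<not> (0 < Im z \<and> Im z < real n \<and> \<bar>Re z\<bar> < real n)"
          unfolding box by (auto simp: in_cbox_complex_iff in_box_complex_iff)
        then show False
          using z n abs_Re_le_cmod[of z] abs_Im_le_cmod[of z] by linarith
      qed
      moreover have "?P \<subseteq> {w. - h < Im w}"
        unfolding box using h by (auto simp: in_cbox_complex_iff)
      ultimately show "continuous_on ?P ?g"
        by (intro continuous_intros continuous_on_subset[OF holomorphic_on_imp_continuous_on[OF hol]]) auto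
      fix w :: complex assume w: "0 \<le> Im w" "real n \<le> norm w"
      have "norm (f w) \<le> C / norm w" using w n by (intro lim) auto
      also have "\<dots> \<le> C / real n" using w n C by (intro divide_left_mono) (auto intro!: mult_pos_pos)
      finally have fw: "norm (f w) \<le> C / real n" .
      have "real n / 2 \<le> norm (w - z)"
        using norm_triangle_ineq2[of w z] w n by linarith
      then have "norm (f w) / norm (w - z) \<le> (C / real n) / (real n / 2)"
        using fw n C by (intro frac_le) auto
      moreover have "(C / real n) / (real n / 2) = 2 * C / (real n)\<^sup>2"
        by (simp add: power2_eq_square)
      ultimately show "norm (?g w) \<le> 2 * C / (real n)\<^sup>2"
        by (simp add: norm_divide)
    qed
    also have "4 * real n * (2 * C / (real n)\<^sup>2) = 8 * C * inverse (real n)"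
      using n by (simp add: power2_eq_square divide_inverse)
    finally show ?case
      unfolding contour_integral_unique[OF elim(1)] by (simp only: norm_minus_commute)
  qed
  moreover have "(\<lambda>n. 8 * C * inverse (real n)) \<longlonglongrightarrow> 0"
    by real_asymp
  ultimately have "(\<lambda>n. ?J n - I) \<longlonglongrightarrow> 0"
    by (rule Lim_null_comparison)
  then show ?thesis by (rule LIM_zero_cancel)
qed

text \<open>Cauchy's formula over large rectangles resting on the real axis gives \<open>f z\<close>, and the same
  integral with \<open>cnj z\<close> in place of \<open>z\<close> vanishes; subtracting the conjugate of the second from the
  first leaves only \<open>Im f\<close> under the integral.\<close>

lemma half_plane_poisson:
  assumes lim: "\<And>w. 0 \<le> Im w \<Longrightarrow> R \<le> norm w \<Longrightarrow> norm (f w) \<le> C / norm w"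
    and R: "0 < R"
    and hol: "f holomorphic_on {w. - h < Im w}" and h: "0 < h"
    and z: "0 < Im z"
  shows "(\<lambda>n. LINT x:{- real n..real n}|lborel.
      complex_of_real (- Im (f (complex_of_real x)) / pi) / (z - complex_of_real x)) \<longlonglongrightarrow> f z"
proof -
  let ?rp = "\<lambda>n. rectpath (complex_of_real (- real n)) (Complex (real n) (real n))"
  let ?S = "\<lambda>r. {w::complex. - r < Im w}"
  have convex: "convex (?S r)" for r by (rule convex_halfspace_Im_gt)
  have sub: "path_image (?rp n) \<subseteq> ?S r" if "0 < r" for r n
    using path_image_rectpath_subset_cbox[of "complex_of_real (- real n)" "Complex (real n) (real n)"] that
    by (force simp: in_cbox_complex_iff)
  have "\<forall>\<^sub>F n in sequentially. ((\<lambda>w. f w / (w - z)) has_contour_integral 2 * pi * \<i> * f z) (?rp n)"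
    using eventually_ge_at_top[of "nat \<lceil>norm z\<rceil> + 1"]
  proof eventually_elim
    case (elim n)
    then have n: "norm z < real n" by linarith
    have zb: "z \<in> box (complex_of_real (- real n)) (Complex (real n) (real n))"
      using z n abs_Re_le_cmod[of z] abs_Im_le_cmod[of z] by (auto simp: in_box_complex_iff)
    have "((\<lambda>w. f w / (w - z)) has_contour_integral (2 * pi * \<i> * winding_number (?rp n) z * f z)) (?rp n)"
    proof (rule Cauchy_integral_formula_convex_simple[OF convex[of h] hol])
      have "open (?S h)" by (rule open_halfspace_Im_gt)
      then show "z \<in> interior (?S h)" using z h by (simp add: interior_open)
      have "z \<notin> path_image (?rp n)"
        using zb path_image_rectpath_inter_box[of "complex_of_real (- real n)" "Complex (real n) (real n)"] by auto
      then show "path_image (?rp n) \<subseteq> ?S h - {z}" using sub[OF h] by auto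
    qed auto
    then show ?case unfolding winding_number_rectpath[OF zb] by simp
  qed
  then have A: "(\<lambda>n. LINT x:{- real n..real n}|lborel. f (complex_of_real x) / (complex_of_real x - z))
      \<longlonglongrightarrow> 2 * pi * \<i> * f z"
    by (intro rectpath_integral_limit[OF lim R hol h]) (use z in auto)
  have "((\<lambda>w. f w / (w - cnj z)) has_contour_integral 0) (?rp n)" for n
  \<comment> \<open>Cutting the half-plane at height \<open>- Im z\<close> leaves the pole
    \<open>cnj z\<close> on its boundary line, outside the open domain.\<close>
  proof (rule Cauchy_theorem_convex_simple[OF _ convex[of "min h (Im z)"]])
    show "(\<lambda>w. f w / (w - cnj z)) holomorphic_on ?S (min h (Im z))"
      by (intro holomorphic_intros holomorphic_on_subset[OF hol]) auto
    show "path_image (?rp n) \<subseteq> ?S (min h (Im z))" using z h by (intro sub) simp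
  qed auto
  then have "(\<lambda>n. LINT x:{- real n..real n}|lborel. f (complex_of_real x) / (complex_of_real x - cnj z))
      \<longlonglongrightarrow> 0"
    by (intro rectpath_integral_limit[OF lim R hol h]) (use z in auto)
  then have "(\<lambda>n. cnj (LINT x:{- real n..real n}|lborel. f (complex_of_real x) / (complex_of_real x - cnj z)))
      \<longlonglongrightarrow> cnj 0"
    by (rule tendsto_cnj)
  \<comment> \<open>Conjugation turns \<open>1 / (x - cnj z)\<close> into \<open>1 / (x - z)\<close>
    on the real axis, so both integrals now have the same denominator.\<close>
  then have B: "(\<lambda>n. LINT x:{- real n..real n}|lborel. cnj (f (complex_of_real x)) / (complex_of_real x - z))
      \<longlonglongrightarrow> 0"
    by (simp add: set_lebesgue_integral_def flip: Bochner_Integration.integral_cnj)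
  have int: "set_integrable lborel {- real n..real n} (\<lambda>x. f (complex_of_real x) / (complex_of_real x - z))"
      "set_integrable lborel {- real n..real n} (\<lambda>x. cnj (f (complex_of_real x)) / (complex_of_real x - z))" for n
    using h z diff_real_nonzero(2)[OF z]
    by (intro borel_integrable_atLeastAtMost' continuous_intros
      continuous_on_compose2[OF holomorphic_on_imp_continuous_on[OF hol]]; force)+
  have eq: "complex_of_real (- Im (f (complex_of_real x)) / pi) / (z - complex_of_real x)
     = 1 / (2 * pi * \<i>) * (f (complex_of_real x) / (complex_of_real x - z)
        - cnj (f (complex_of_real x)) / (complex_of_real x - z))" for x
  proof -
    have "f (complex_of_real x) - cnj (f (complex_of_real x)) = 2 * \<i> * complex_of_real (Im (f (complex_of_real x)))"
      by (simp add: complex_eq_iff)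
    then show ?thesis
      using diff_real_nonzero[OF z, of x]
      by (simp flip: diff_divide_distrib) (simp add: field_simps)
  qed
  have "(\<lambda>n. 1 / (2 * pi * \<i>) *
      ((LINT x:{- real n..real n}|lborel. f (complex_of_real x) / (complex_of_real x - z))
      - (LINT x:{- real n..real n}|lborel. cnj (f (complex_of_real x)) / (complex_of_real x - z))))
     \<longlonglongrightarrow> 1 / (2 * pi * \<i>) * (2 * pi * \<i> * f z - 0)"
    by (intro tendsto_intros A B)
  then show ?thesis
    unfolding eq set_integral_mult_right set_integral_diff(2)[OF int] by simp
qed

lemma Im_vertical_kernel:
  "Im (complex_of_real c / (\<i> * complex_of_real y - complex_of_real x)) = - c * y / (x\<^sup>2 + y\<^sup>2)"
  by (simp add: Im_divide)

text \<open>The Poisson formula only gives a limit over growing intervals. Nonnegativity of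
  \<open>p\<close> upgrades it by monotone convergence: first for a weighted \<open>p\<close>, then
  for \<open>p\<close> itself as the weight increases to 1.\<close>

lemma half_plane_density:
  assumes lim: "\<And>w. 0 \<le> Im w \<Longrightarrow> R \<le> norm w \<Longrightarrow> norm (f w) \<le> C / norm w"
    and R: "0 < R"
    and hol: "f holomorphic_on {w. - h < Im w}" and h: "0 < h"
    and neg: "\<And>x. Im (f (complex_of_real x)) \<le> 0"
    and one: "((\<lambda>y. \<i> * complex_of_real y * f (\<i> * complex_of_real y)) \<longlongrightarrow> 1) at_top"
  defines "p \<equiv> \<lambda>x. - Im (f (complex_of_real x)) / pi"
  shows "has_bochner_integral lborel p 1"
proof -
  have contp: "continuous_on UNIV p"
    unfolding p_def
    by (intro continuous_intros continuous_on_compose2[OF holomorphic_on_imp_continuous_on[OF hol]])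
       (use h in auto)
  then have [measurable]: "p \<in> borel_measurable borel"
    by (rule borel_measurable_continuous_onI)
  have p0: "0 \<le> p x" for x unfolding p_def using neg[of x] by (simp add: divide_nonpos_pos)
  \<comment> \<open>Real part of the Poisson formula at \<open>i y\<close>, multiplied by
    \<open>i y\<close>. The weight \<open>y^2 / (x^2 + y^2)\<close> increases with \<open>y\<close>,
    which permits the second passage to the limit.\<close>
  have weighted: "has_bochner_integral lborel (\<lambda>x. p x * (y\<^sup>2 / (x\<^sup>2 + y\<^sup>2)))
      (Re (\<i> * complex_of_real y * f (\<i> * complex_of_real y)))" if y: "0 < y" for y
  proof -
    let ?q = "\<lambda>x. p x * (y\<^sup>2 / (x\<^sup>2 + y\<^sup>2))"
    let ?c = "\<lambda>x. complex_of_real (p x) / (\<i> * complex_of_real y - complex_of_real x)"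
    have cont: "continuous_on {- real n..real n} ?c" for n
      using y by (intro continuous_intros continuous_on_subset[OF contp]) (auto simp: complex_eq_iff)
    have int_c: "set_integrable lborel {- real n..real n} ?c" for n
      by (rule borel_integrable_atLeastAtMost'[OF cont])
    have q_eq: "indicator {- real n..real n} x * ?q x = - y * Im (indicator {- real n..real n} x *\<^sub>R ?c x)" for n x
      by (simp add: Im_vertical_kernel power2_eq_square split: split_indicator)
    have int_q: "integrable lborel (\<lambda>x. indicator {- real n..real n} x * ?q x)" for n
      unfolding q_eq using int_c[of n] unfolding set_integrable_def
      by (intro integrable_mult_right integrable_Im)
    have val_q: "(LINT x|lborel. indicator {- real n..real n} x * ?q x)
       = - y * Im (LINT x:{- real n..real n}|lborel. ?c x)" for n
      unfolding q_eq set_lebesgue_integral_def using int_c[of n] unfolding set_integrable_def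
      by (simp only: integral_mult_right_zero integral_Im)
    have "(\<lambda>n. LINT x:{- real n..real n}|lborel. ?c x) \<longlonglongrightarrow> f (\<i> * complex_of_real y)"
      unfolding p_def using half_plane_poisson[OF lim R hol h, of "\<i> * complex_of_real y"] y by simp
    then have "(\<lambda>n. - y * Im (LINT x:{- real n..real n}|lborel. ?c x)) \<longlonglongrightarrow> - y * Im (f (\<i> * complex_of_real y))"
      by (intro tendsto_intros)
    then have L: "(\<lambda>n. LINT x|lborel. indicator {- real n..real n} x * ?q x)
        \<longlonglongrightarrow> Re (\<i> * complex_of_real y * f (\<i> * complex_of_real y))"
      unfolding val_q by simp
    have q0: "0 \<le> ?q x" for x using p0 by simp
    have pw: "(\<lambda>n. indicator {- real n..real n} x * ?q x) \<longlonglongrightarrow> ?q x" for x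
    proof (rule tendsto_eventually)
      show "\<forall>\<^sub>F n in sequentially. indicator {- real n..real n} x * ?q x = ?q x"
        using eventually_ge_at_top[of "nat \<lceil>\<bar>x\<bar>\<rceil>"]
      proof eventually_elim
        case (elim n)
        then have "- real n \<le> x \<and> x \<le> real n" by linarith
        then show ?case by (simp add: indicator_def)
      qed
    qed
    have mono: "mono (\<lambda>n. indicator {- real n..real n} x * ?q x)" for x
      using q0 by (intro monoI mult_right_mono) (auto simp: indicator_def)
    have m: "?q \<in> borel_measurable lborel" by measurable
    have iq0: "0 \<le> indicator {- real n..real n} x * ?q x" for n x
      by (intro mult_nonneg_nonneg q0) auto
    show ?thesis
      unfolding has_bochner_integral_iff
      using integral_monotone_convergence_nonneg[OF int_q AE_I2[OF mono] AE_I2[OF iq0] AE_I2[OF pw] L m]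
      by (rule conjI)
  qed
  have "integrable lborel p" "integral\<^sup>L lborel p = 1"
  proof -
    let ?q = "\<lambda>k x. p x * ((real (Suc k))\<^sup>2 / (x\<^sup>2 + (real (Suc k))\<^sup>2))"
    have int: "integrable lborel (?q k)" for k
      using weighted[of "real (Suc k)"] by (simp add: has_bochner_integral_iff)
    have val: "integral\<^sup>L lborel (?q k) = Re (\<i> * complex_of_real (real (Suc k)) * f (\<i> * complex_of_real (real (Suc k))))" for k
      using has_bochner_integral_integral_eq[OF weighted[of "real (Suc k)"]] by simp
    have mono: "mono (\<lambda>k. ?q k x)" for x
    proof (intro monoI mult_left_mono p0)
      fix k l :: nat assume "k \<le> l"
      define a b where "a = (real (Suc k))\<^sup>2" and "b = (real (Suc l))\<^sup>2"
      have ab: "0 < a" "a \<le> b" unfolding a_def b_def using \<open>k \<le> l\<close> by (auto intro!: power_mono)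
      then have "a * x\<^sup>2 \<le> b * x\<^sup>2" by (intro mult_right_mono) auto
      moreover have "0 < x\<^sup>2 + a" "0 < x\<^sup>2 + b" using ab by (auto intro: add_nonneg_pos)
      ultimately have "a / (x\<^sup>2 + a) \<le> b / (x\<^sup>2 + b)"
        by (simp add: divide_simps) (simp add: algebra_simps)
      then show "(real (Suc k))\<^sup>2 / (x\<^sup>2 + (real (Suc k))\<^sup>2) \<le> (real (Suc l))\<^sup>2 / (x\<^sup>2 + (real (Suc l))\<^sup>2)"
        unfolding a_def b_def .
    qed
    have pw: "(\<lambda>k. ?q k x) \<longlonglongrightarrow> p x" for x
    proof -
      have "(\<lambda>k. (real (Suc k))\<^sup>2 / (x\<^sup>2 + (real (Suc k))\<^sup>2)) \<longlonglongrightarrow> 1" by real_asymp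
      then have "(\<lambda>k. ?q k x) \<longlonglongrightarrow> p x * 1" by (intro tendsto_intros)
      then show ?thesis by simp
    qed
    have "filterlim (\<lambda>k. real (Suc k)) at_top sequentially" by real_asymp
    from tendsto_Re[OF filterlim_compose[OF one this]]
    have L: "(\<lambda>k. integral\<^sup>L lborel (?q k)) \<longlonglongrightarrow> 1" unfolding val by simp
    have q0: "0 \<le> ?q k x" for k x using p0 by simp
    have m: "p \<in> borel_measurable lborel" by measurable
    show "integrable lborel p" "integral\<^sup>L lborel p = 1"
      by (rule integral_monotone_convergence_nonneg[OF int AE_I2[OF mono] AE_I2[OF q0] AE_I2[OF pw] L m])+
  qed
  then show ?thesis by (simp add: has_bochner_integral_iff)
qed

text \<open>When \<open>f\<close> extends past the real axis the measure is explicit: it has the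
  density \<open>- Im f / pi\<close>. Integrability of this density makes the truncated Poisson
  integrals converge to the full Cauchy integral.\<close>

lemma cauchy_transform_exists_strip:
  assumes lim: "\<And>w. 0 \<le> Im w \<Longrightarrow> R \<le> norm w \<Longrightarrow> norm (f w) \<le> C / norm w"
    and R: "0 < R"
    and hol: "f holomorphic_on {w. - h < Im w}" and h: "0 < h"
    and neg: "\<And>x. Im (f (complex_of_real x)) \<le> 0"
    and one: "((\<lambda>y. \<i> * complex_of_real y * f (\<i> * complex_of_real y)) \<longlongrightarrow> 1) at_top"
  obtains M where "real_distribution M" "\<And>z. 0 < Im z \<Longrightarrow> cauchy_transform M z = f z"
proof
  define p where "p = (\<lambda>x. - Im (f (complex_of_real x)) / pi)"
  have contp: "continuous_on UNIV p"
    unfolding p_def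
    by (intro continuous_intros continuous_on_compose2[OF holomorphic_on_imp_continuous_on[OF hol]])
       (use h in auto)
  then have [measurable]: "p \<in> borel_measurable borel"
    by (rule borel_measurable_continuous_onI)
  have p0: "0 \<le> p x" for x unfolding p_def using neg[of x] by (simp add: divide_nonpos_pos)
  have "has_bochner_integral lborel p 1"
    unfolding p_def by (rule half_plane_density[OF lim R hol h neg one])
  then have intp: "integrable lborel p" and p1: "integral\<^sup>L lborel p = 1"
    by (auto simp: has_bochner_integral_iff)
  define M where "M = density lborel (\<lambda>x. ennreal (p x))"
  have "emeasure M (space M) = 1"
    using nn_integral_eq_integral[OF intp] p0 p1 by (simp add: M_def emeasure_density)
  then interpret prob_space M by (rule prob_spaceI)
  show "real_distribution M"
    by unfold_locales (simp_all add: M_def)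
  fix z :: complex assume z: "0 < Im z"
  let ?g = "\<lambda>x. complex_of_real (p x) / (z - complex_of_real x)"
  have "(\<lambda>n. LINT x:{- real n..real n}|lborel. ?g x) \<longlonglongrightarrow> (LINT x|lborel. ?g x)"
    unfolding set_lebesgue_integral_def
  proof (rule integral_dominated_convergence[where w = "\<lambda>x. p x * (1 / Im z)"])
    show "integrable lborel (\<lambda>x. p x * (1 / Im z))" by (rule integrable_mult_left[OF intp])
    show "AE x in lborel. (\<lambda>n. indicator {- real n..real n} x *\<^sub>R ?g x) \<longlonglongrightarrow> ?g x"
    proof (intro AE_I2 tendsto_eventually)
      fix x
      show "\<forall>\<^sub>F n in sequentially. indicator {- real n..real n} x *\<^sub>R ?g x = ?g x"
        using eventually_ge_at_top[of "nat \<lceil>\<bar>x\<bar>\<rceil>"]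
      proof eventually_elim
        case (elim n)
        then have "- real n \<le> x \<and> x \<le> real n" by linarith
        then show ?case by (simp add: indicator_def)
      qed
    qed
    fix n
    show "AE x in lborel. norm (indicator {- real n..real n} x *\<^sub>R ?g x) \<le> p x * (1 / Im z)"
    proof (rule AE_I2)
      fix x
      have "norm (?g x) = p x * norm (1 / (z - complex_of_real x))"
        using p0 by (simp add: norm_divide)
      also have "\<dots> \<le> p x * (1 / Im z)"
        by (intro mult_left_mono norm_cauchy_kernel_le z p0)
      finally show "norm (indicator {- real n..real n} x *\<^sub>R ?g x) \<le> p x * (1 / Im z)"
        using p0 z by (auto simp: indicator_def)
    qed
  qed auto
  moreover have "(\<lambda>n. LINT x:{- real n..real n}|lborel. ?g x) \<longlonglongrightarrow> f z"
    unfolding p_def by (rule half_plane_poisson[OF lim R hol h z])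
  ultimately have "(LINT x|lborel. ?g x) = f z" by (rule LIMSEQ_unique)
  moreover have "cauchy_transform M z = (LINT x|lborel. p x *\<^sub>R (1 / (z - complex_of_real x)))"
    unfolding cauchy_transform_def M_def by (rule integral_density) (use p0 in auto)
  ultimately show "cauchy_transform M z = f z" by (simp add: scaleR_conv_of_real)
qed

section \<open>Tightness and pointwise limits of Cauchy transforms\<close>

text \<open>The real part of \<open>i y G(i y)\<close> is the integral of
  \<open>q = y^2 / (x^2 + y^2)\<close>, and \<open>q \<le> 1/2\<close> where
  \<open>|x| \<ge> y\<close>; hence the indicator of the tail is at most \<open>2 (1 - q)\<close>.
  Tails are controlled by the transform at one point.\<close>

lemma (in real_distribution) measure_tail_le:
  assumes y: "0 < y"
  shows "measure M {x. y \<le> \<bar>x\<bar>} \<le> 2 * norm (\<i> * complex_of_real y * cauchy_transform M (\<i> * complex_of_real y) - 1)"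
proof -
  define q where "q x = y\<^sup>2 / (x\<^sup>2 + y\<^sup>2)" for x
  have q: "0 \<le> q x" "q x \<le> 1" for x unfolding q_def using y by (auto simp: divide_le_eq_1 intro: add_nonneg_pos)
  have [measurable]: "q \<in> borel_measurable borel" unfolding q_def by measurable
  have intq: "integrable M q" using q by (intro integrable_bounded[of _ 1]) auto
  have [measurable]: "{x::real. y \<le> \<bar>x\<bar>} \<in> sets borel" by measurable
  have "Re (\<i> * complex_of_real y * cauchy_transform M (\<i> * complex_of_real y))
      = - y * Im (cauchy_transform M (\<i> * complex_of_real y))" by simp
  also have "Im (cauchy_transform M (\<i> * complex_of_real y))
     = (LINT x|M. Im (complex_of_real 1 / (\<i> * complex_of_real y - complex_of_real x)))"
    unfolding cauchy_transform_def using integrable_cauchy_kernel[of "\<i> * complex_of_real y"] y by simp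
  also have "- y * \<dots> = (LINT x|M. q x)"
    unfolding Im_vertical_kernel integral_mult_right_zero[symmetric] q_def by (simp add: power2_eq_square)
  finally have Re_eq: "Re (\<i> * complex_of_real y * cauchy_transform M (\<i> * complex_of_real y)) = (LINT x|M. q x)" .
  have "measure M {x. y \<le> \<bar>x\<bar>} = (LINT x|M. indicator {x. y \<le> \<bar>x\<bar>} x)"
    by simp
  also have "\<dots> \<le> (LINT x|M. 2 * (1 - q x))"
  proof (rule integral_mono)
    fix x
    show "indicator {x. y \<le> \<bar>x\<bar>} x \<le> 2 * (1 - q x)"
    proof (cases "y \<le> \<bar>x\<bar>")
      case True
      then have "y\<^sup>2 \<le> x\<^sup>2" using y by (simp add: abs_le_square_iff[symmetric])
      then have "q x \<le> 1 / 2" unfolding q_def using y by (simp add: divide_simps add_nonneg_pos)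
      then show ?thesis using True by simp
    qed (use q(2)[of x] in simp)
  qed (use intq in \<open>auto intro!: integrable_bounded[of _ 1]\<close>)
  also have "\<dots> = 2 * (1 - (LINT x|M. q x))"
    using intq prob_space by simp
  also have "\<dots> \<le> 2 * norm (\<i> * complex_of_real y * cauchy_transform M (\<i> * complex_of_real y) - 1)"
    using abs_Re_le_cmod[of "\<i> * complex_of_real y * cauchy_transform M (\<i> * complex_of_real y) - 1"]
    unfolding Re_eq[symmetric] by simp
  finally show ?thesis .
qed

text \<open>The condition at infinity prevents loss of mass. It gives one height \<open>y\<close> at
  which the tail bound holds for all large \<open>n\<close>, and each of the finitely many remaining
  measures has its own; \<open>\<epsilon> / 4\<close> absorbs the factor 2 of
  \<open>measure_tail_le\<close>. Helly's selection then applies, and the Cauchy kernel is a bounded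
  continuous test function, so the limit measure has transform \<open>g\<close>.\<close>

theorem cauchy_transform_limit:
  assumes dist: "\<And>n. real_distribution (\<rho> n)"
    and conv: "\<And>z. 0 < Im z \<Longrightarrow> (\<lambda>n. cauchy_transform (\<rho> n) z) \<longlonglongrightarrow> g z"
    and one: "((\<lambda>y. \<i> * complex_of_real y * g (\<i> * complex_of_real y)) \<longlongrightarrow> 1) at_top"
  obtains M where "real_distribution M" "\<And>z. 0 < Im z \<Longrightarrow> cauchy_transform M z = g z"
proof -
  interpret \<rho>: real_distribution "\<rho> n" for n by (rule dist)
  have "tight \<rho>"
    unfolding tight_def
  proof (intro conjI allI impI dist)
    fix \<epsilon> :: real assume \<epsilon>: "0 < \<epsilon>"
    let ?P = "\<lambda>n y. measure (\<rho> n) {x. y \<le> \<bar>x\<bar>} < \<epsilon>"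
    have P_mono: "?P n y'" if "?P n y" "y \<le> y'" for n y y'
      using that \<rho>.finite_measure_mono[of "{x. y' \<le> \<bar>x\<bar>}" "{x. y \<le> \<bar>x\<bar>}" n] by fastforce
    have "\<forall>\<^sub>F y in at_top. dist (\<i> * complex_of_real y * g (\<i> * complex_of_real y)) 1 < \<epsilon> / 4"
      using one \<epsilon> by (intro tendstoD) auto
    then have "\<forall>\<^sub>F y in at_top. dist (\<i> * complex_of_real y * g (\<i> * complex_of_real y)) 1 < \<epsilon> / 4 \<and> 0 < y"
      using eventually_gt_at_top[of 0] by eventually_elim auto
    then obtain y where y: "dist (\<i> * complex_of_real y * g (\<i> * complex_of_real y)) 1 < \<epsilon> / 4" "0 < y"
      using eventually_happens[of _ "at_top :: real filter"] by auto
    have "(\<lambda>n. dist (\<i> * complex_of_real y * cauchy_transform (\<rho> n) (\<i> * complex_of_real y)) 1)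
       \<longlonglongrightarrow> dist (\<i> * complex_of_real y * g (\<i> * complex_of_real y)) 1"
      using y by (intro tendsto_intros conv) auto
    then have "\<forall>\<^sub>F n in sequentially. dist (\<i> * complex_of_real y * cauchy_transform (\<rho> n) (\<i> * complex_of_real y)) 1 < \<epsilon> / 4"
      by (rule order_tendstoD(2)[OF _ y(1)])
    then have "\<forall>\<^sub>F n in sequentially. ?P n y"
    proof eventually_elim
      case (elim n)
      then show ?case using \<rho>.measure_tail_le[OF y(2), of n] \<epsilon> by (simp add: dist_norm)
    qed
    then obtain N where N: "\<And>n. N \<le> n \<Longrightarrow> ?P n y" by (auto simp: eventually_sequentially)
    have "\<forall>\<^sub>F y in at_top. ?P n y" for n
    proof -
      have "\<forall>\<^sub>F y in at_top. dist (\<i> * complex_of_real y * cauchy_transform (\<rho> n) (\<i> * complex_of_real y)) 1 < \<epsilon> / 4"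
        using \<rho>.cauchy_transform_vertical_limit \<epsilon> by (intro tendstoD) auto
      then show ?thesis using eventually_gt_at_top[of 0]
      proof eventually_elim
        case (elim y)
        then show ?case using \<rho>.measure_tail_le[OF elim(2), of n] \<epsilon> by (simp add: dist_norm)
      qed
    qed
    then have "\<forall>\<^sub>F y' in at_top. (\<forall>n\<in>{..<N}. ?P n y') \<and> y \<le> y'"
      by (intro eventually_conj eventually_ball_finite eventually_ge_at_top) auto
    from eventually_happens[OF this] obtain y' where y': "\<And>n. n < N \<Longrightarrow> ?P n y'" "y \<le> y'"
      by auto
    have P: "?P n y'" for n
      using y'(1)[of n] P_mono[OF N[of n] y'(2)] by (cases "n < N") auto
    have "1 - \<epsilon> < measure (\<rho> n) {- y'<..y'}" for n
    proof -
      have [measurable]: "{x::real. y' \<le> \<bar>x\<bar>} \<in> sets borel" by measurable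
      have "1 - measure (\<rho> n) {x. y' \<le> \<bar>x\<bar>} = measure (\<rho> n) (space (\<rho> n) - {x. y' \<le> \<bar>x\<bar>})"
        by (rule \<rho>.prob_compl[symmetric]) simp
      also have "\<dots> \<le> measure (\<rho> n) {- y'<..y'}"
        by (intro \<rho>.finite_measure_mono) auto
      finally show ?thesis using P[of n] by linarith
    qed
    then show "\<exists>a b. a < b \<and> (\<forall>n. 1 - \<epsilon> < measure (\<rho> n) {a<..b})"
      using y y'(2) by (intro exI[of _ "- y'"] exI[of _ y']) auto
  qed
  from tight_imp_convergent_subsubsequence[OF this strict_mono_id]
  obtain r M where r: "strict_mono r" and M: "real_distribution M" and w: "weak_conv_m (\<rho> \<circ> r) M"
    by auto
  show thesis
  proof (rule that[OF M])
    fix z :: complex assume z: "0 < Im z"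
    have "(\<lambda>n. cauchy_transform ((\<rho> \<circ> r) n) z) \<longlonglongrightarrow> cauchy_transform M z"
      unfolding cauchy_transform_def
    proof (rule weak_conv_imp_integral_bdd_continuous_conv[OF _ M w])
      show "isCont (\<lambda>x. 1 / (z - complex_of_real x)) x" for x
        using diff_real_nonzero[OF z] by (intro continuous_intros) auto
      show "norm (1 / (z - complex_of_real x)) \<le> 1 / Im z" for x
        by (rule norm_cauchy_kernel_le[OF z])
    qed (simp add: dist)
    moreover have "(\<lambda>n. cauchy_transform ((\<rho> \<circ> r) n) z) \<longlonglongrightarrow> g z"
      using LIMSEQ_subseq_LIMSEQ[OF conv[OF z] r] by (simp add: comp_def)
    ultimately show "cauchy_transform M z = g z" by (rule LIMSEQ_unique)
  qed
qed

section \<open>Existence of a measure with a prescribed K-transform\<close>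

text \<open>The function \<open>1 / (z - K z)\<close> need not extend to the real axis, but its
  translate by \<open>i h\<close> is holomorphic on a strip below it, and boundedness of
  \<open>K\<close> gives the required decay. Then \<open>h\<close> tends to 0 along
  \<open>1 / (n + 1)\<close>.\<close>

lemma K_transform_exists_bounded:
  assumes hol: "K holomorphic_on upper"
    and neg: "\<And>z. 0 < Im z \<Longrightarrow> Im (K z) \<le> 0"
    and bdd: "\<And>h. 0 < h \<Longrightarrow> \<exists>c. \<forall>z. h \<le> Im z \<longrightarrow> norm (K z) \<le> c"
  obtains M where "real_distribution M" "\<And>z. 0 < Im z \<Longrightarrow> K_transform M z = K z"
proof -
  define G where "G z = 1 / (z - K z)" for z
  have F: "Im z \<le> Im (z - K z)" if "0 < Im z" for z using neg[OF that] by simp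
  have F0: "z - K z \<noteq> 0" if "0 < Im z" for z using F[OF that] that by auto
  have holG: "G holomorphic_on upper"
    unfolding G_def by (intro holomorphic_intros hol) (use F0 in auto)
  have vert: "((\<lambda>y. \<i> * complex_of_real y * G (\<i> * complex_of_real y + \<i> * complex_of_real h)) \<longlongrightarrow> 1) at_top"
    if h: "0 \<le> h" for h
  proof -
    obtain c where c: "\<And>z. 1 \<le> Im z \<Longrightarrow> norm (K z) \<le> c" using bdd[of 1] by auto
    let ?z = "\<lambda>y. \<i> * complex_of_real y + \<i> * complex_of_real h"
    let ?e = "\<lambda>y. (\<i> * complex_of_real h - K (?z y)) * (1 / (\<i> * complex_of_real y))"
    have lim0: "(?e \<longlongrightarrow> 0) at_top"
    proof (rule Lim_null_comparison)
      show "\<forall>\<^sub>F y in at_top. norm (?e y) \<le> (h + c) / y"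
        using eventually_ge_at_top[of 1]
      proof eventually_elim
        case (elim y)
        have "norm (\<i> * complex_of_real h - K (?z y)) \<le> h + c"
          using norm_triangle_ineq4[of "\<i> * complex_of_real h" "K (?z y)"] c[of "?z y"] elim h
          by (simp add: norm_mult)
        then show ?case using elim by (simp add: norm_mult norm_divide divide_right_mono)
      qed
      show "((\<lambda>y. (h + c) / y) \<longlongrightarrow> 0) at_top" by real_asymp
    qed
    have "((\<lambda>y. 1 / (1 + ?e y)) \<longlongrightarrow> 1 / (1 + 0)) at_top"
      by (intro tendsto_intros lim0) auto
    then have lim1: "((\<lambda>y. 1 / (1 + ?e y)) \<longlongrightarrow> 1) at_top" by simp
    show ?thesis
    proof (rule Lim_transform_eventually[OF lim1])
      show "\<forall>\<^sub>F y in at_top. 1 / (1 + ?e y) = \<i> * complex_of_real y * G (?z y)"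
        using eventually_gt_at_top[of 0]
      proof eventually_elim
        case (elim y)
        have y0: "\<i> * complex_of_real y \<noteq> 0" using elim by simp
        then have "\<i> * complex_of_real y * (1 + ?e y) = ?z y - K (?z y)"
          by (simp only: distrib_left) simp
        then show ?case
          unfolding G_def using y0
          by (metis mult_divide_mult_cancel_left mult.right_neutral times_divide_eq_right)
      qed
    qed
  qed
  have ex: "\<exists>M. real_distribution M \<and> (\<forall>z. 0 < Im z \<longrightarrow> cauchy_transform M z = G (z + \<i> * complex_of_real h))"
    if h: "0 < h" for h
  proof -
    obtain c where c: "\<And>z. h \<le> Im z \<Longrightarrow> norm (K z) \<le> c" using bdd[OF h] by auto
    have c0: "0 \<le> c" by (rule order_trans[OF norm_ge_zero c[of "\<i> * complex_of_real h"]]) simp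
    let ?f = "\<lambda>w. G (w + \<i> * complex_of_real h)"
    obtain M where "real_distribution M" "\<And>z. 0 < Im z \<Longrightarrow> cauchy_transform M z = ?f z"
    \<comment> \<open>For \<open>norm w \<ge> 2 (h + c)\<close> the denominator differs from
      \<open>w\<close> by at most \<open>h + c\<close>, hence has modulus at least
      \<open>norm w / 2\<close>. This yields the radius and the decay constant 2.\<close>
    proof (rule cauchy_transform_exists_strip[of "2 * (h + c)" ?f 2 h])
      fix w :: complex assume w: "0 \<le> Im w" "2 * (h + c) \<le> norm w"
      let ?z = "w + \<i> * complex_of_real h"
      have "norm w = norm ((?z - K ?z) + (K ?z - \<i> * complex_of_real h))" by simp
      also have "\<dots> \<le> norm (?z - K ?z) + (norm (K ?z) + norm (\<i> * complex_of_real h))"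
        by (intro order_trans[OF norm_triangle_ineq] add_left_mono norm_triangle_ineq4)
      also have "\<dots> \<le> norm (?z - K ?z) + (c + h)"
        using c[of ?z] w h by (simp add: norm_mult)
      finally have "norm w / 2 \<le> norm (?z - K ?z)" using w by simp
      then have "1 / norm (?z - K ?z) \<le> 1 / (norm w / 2)"
        using w h c0 by (intro frac_le) auto
      then show "norm (?f w) \<le> 2 / norm w"
        unfolding G_def by (simp add: norm_divide)
    next
      show "?f holomorphic_on {w. - h < Im w}"
        by (rule holomorphic_on_compose_gen[OF _ holG, unfolded comp_def])
           (auto intro!: holomorphic_intros)
    next
      fix x
      let ?z = "complex_of_real x + \<i> * complex_of_real h"
      have "0 < Im (?z - K ?z)" using F[of ?z] h by simp
      then show "Im (?f (complex_of_real x)) \<le> 0"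
        unfolding G_def by (simp add: Im_divide divide_nonpos_nonneg)
    qed (use h c0 vert[of h] in auto)
    then show ?thesis by blast
  qed
  have "\<exists>\<rho>. \<forall>n. real_distribution (\<rho> n) \<and> (\<forall>z. 0 < Im z \<longrightarrow>
      cauchy_transform (\<rho> n) z = G (z + \<i> * complex_of_real (1 / real (Suc n))))"
    by (rule choice, rule allI, rule ex) simp
  then obtain \<rho> where \<rho>: "\<And>n. real_distribution (\<rho> n)"
    "\<And>n z. 0 < Im z \<Longrightarrow> cauchy_transform (\<rho> n) z = G (z + \<i> * complex_of_real (1 / real (Suc n)))"
    by blast
  obtain M where M: "real_distribution M" "\<And>z. 0 < Im z \<Longrightarrow> cauchy_transform M z = G z"
  proof (rule cauchy_transform_limit[of \<rho> G, OF \<rho>(1)])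
    fix z :: complex assume z: "0 < Im z"
    have "isCont G z"
      using holomorphic_on_imp_continuous_on[OF holG] z open_upper
      by (simp add: continuous_on_eq_continuous_at)
    moreover have "(\<lambda>n. z + \<i> * complex_of_real (1 / real (Suc n))) \<longlonglongrightarrow> z + \<i> * complex_of_real 0"
    proof (intro tendsto_intros)
      show "(\<lambda>n. 1 / real (Suc n)) \<longlonglongrightarrow> 0" by real_asymp
    qed
    ultimately have "(\<lambda>n. G (z + \<i> * complex_of_real (1 / real (Suc n)))) \<longlonglongrightarrow> G z"
      by (intro isCont_tendsto_compose[of z G]) simp_all
    then show "(\<lambda>n. cauchy_transform (\<rho> n) z) \<longlonglongrightarrow> G z" using \<rho>(2)[OF z] by simp
  next
    show "((\<lambda>y. \<i> * complex_of_real y * G (\<i> * complex_of_real y)) \<longlongrightarrow> 1) at_top"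
      using vert[of 0] by simp
  qed (rule that)
  show thesis
    by (rule that[OF M(1)]) (simp add: K_transform_def F_transform_def M(2) G_def)
qed

text \<open>Nevanlinna's characterisation of K-transforms. The Moebius map \<open>k \<mapsto> k / (1 + i k / n)\<close> takes the
  closed lower half-plane into a bounded part of itself and tends to the identity, which reduces the
  claim to bounded functions.\<close>

theorem K_transform_exists:
  assumes hol: "K holomorphic_on upper"
    and neg: "\<And>z. 0 < Im z \<Longrightarrow> Im (K z) \<le> 0"
    and vert: "((\<lambda>y. K (\<i> * complex_of_real y) / complex_of_real y) \<longlongrightarrow> 0) at_top"
  obtains M where "real_distribution M" "\<And>z. 0 < Im z \<Longrightarrow> K_transform M z = K z"
proof -
  define L where "L n z = K z / (1 + \<i> * K z / complex_of_real (real (Suc n)))" for n z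
  have Re_den: "1 \<le> Re (1 + \<i> * K z / complex_of_real (real (Suc n)))" if "0 < Im z" for n z
    using neg[OF that] by (simp add: divide_nonpos_pos del: of_nat_Suc)
  have den: "1 + \<i> * K z / complex_of_real (real (Suc n)) \<noteq> 0" if "0 < Im z" for n z
    using Re_den[OF that, of n] by (metis not_one_le_zero zero_complex.sel(1))
  have "\<exists>M. real_distribution M \<and> (\<forall>z. 0 < Im z \<longrightarrow> K_transform M z = L n z)" for n
  proof -
    let ?m = "real (Suc n)"
    obtain M where "real_distribution M" "\<And>z. 0 < Im z \<Longrightarrow> K_transform M z = L n z"
    proof (rule K_transform_exists_bounded[of "L n"])
      show "L n holomorphic_on upper"
        unfolding L_def by (intro holomorphic_intros hol) (use den in auto)
    next
      fix z :: complex assume z: "0 < Im z"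
      let ?d = "1 + \<i> * K z / complex_of_real ?m"
      have "Im (K z) * Re ?d - Re (K z) * Im ?d = Im (K z) - (norm (K z))\<^sup>2 / ?m"
        unfolding cmod_power2 by (simp add: field_simps power2_eq_square del: of_nat_Suc)
      also have "\<dots> \<le> 0" using order_trans[OF neg[OF z], of "(norm (K z))\<^sup>2 / ?m"] by simp
      finally show "Im (L n z) \<le> 0"
        unfolding L_def by (simp add: Im_divide divide_nonpos_nonneg del: of_nat_Suc)
    next
      fix h :: real
      assume h: "0 < h"
      have "norm (L n z) \<le> ?m" if "0 < Im z" for z
      proof -
        have "norm (K z) = norm (\<i> * K z)" by (simp add: norm_mult)
        \<comment> \<open>The real part of \<open>i K z\<close> is \<open>- Im (K z)\<close>, which
          is nonnegative, so adding the positive number \<open>?m\<close> cannot decrease the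
          modulus.\<close>
        also have "\<dots> \<le> norm (complex_of_real ?m + \<i> * K z)"
        proof -
          have "(norm (\<i> * K z))\<^sup>2 \<le> (norm (complex_of_real ?m + \<i> * K z))\<^sup>2"
            unfolding cmod_power2 using neg[OF that]
            by (intro add_mono) (auto simp: abs_le_square_iff[symmetric] simp del: of_nat_Suc)
          then show ?thesis by (rule power2_le_imp_le) simp
        qed
        also have "complex_of_real ?m + \<i> * K z = complex_of_real ?m * (1 + \<i> * K z / complex_of_real ?m)"
          by (simp add: field_simps del: of_nat_Suc)
        finally have "norm (K z) \<le> ?m * norm (1 + \<i> * K z / complex_of_real ?m)"
          by (simp add: norm_mult del: of_nat_Suc)
        then show ?thesis
          unfolding L_def using den[OF that, of n] by (simp add: norm_divide divide_le_eq del: of_nat_Suc)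
      qed
      then show "\<exists>c. \<forall>z. h \<le> Im z \<longrightarrow> norm (L n z) \<le> c" using h by force
    qed (rule that)
    then show ?thesis by blast
  qed
  then have "\<exists>\<rho>. \<forall>n. real_distribution (\<rho> n) \<and> (\<forall>z. 0 < Im z \<longrightarrow> K_transform (\<rho> n) z = L n z)"
    by (intro choice allI)
  then obtain \<rho> where \<rho>: "\<And>n. real_distribution (\<rho> n)"
    "\<And>n z. 0 < Im z \<Longrightarrow> K_transform (\<rho> n) z = L n z" by blast
  have G_\<rho>: "cauchy_transform (\<rho> n) z = 1 / (z - L n z)" if "0 < Im z" for n z
    unfolding \<rho>(2)[OF that, symmetric] K_transform_def F_transform_def by simp
  have F0: "z - K z \<noteq> 0" if "0 < Im z" for z using neg[OF that] that by (auto simp: complex_eq_iff)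
  obtain M where M: "real_distribution M" "\<And>z. 0 < Im z \<Longrightarrow> cauchy_transform M z = 1 / (z - K z)"
  proof (rule cauchy_transform_limit[of \<rho> "\<lambda>z. 1 / (z - K z)", OF \<rho>(1)])
    fix z :: complex assume z: "0 < Im z"
    have "(\<lambda>n. L n z) \<longlonglongrightarrow> K z / (1 + \<i> * K z * 0)"
      unfolding L_def divide_inverse
    proof (intro tendsto_intros)
      have "(\<lambda>n. complex_of_real (inverse (real (Suc n)))) \<longlonglongrightarrow> complex_of_real 0"
        by (intro tendsto_of_real LIMSEQ_inverse_real_of_nat)
      then show "(\<lambda>n. inverse (complex_of_real (real (Suc n)))) \<longlonglongrightarrow> 0"
        by (simp only: of_real_inverse of_real_0)
    qed auto
    then have "(\<lambda>n. 1 / (z - L n z)) \<longlonglongrightarrow> 1 / (z - K z)"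
      by (intro tendsto_intros) (use F0[OF z] in auto)
    then show "(\<lambda>n. cauchy_transform (\<rho> n) z) \<longlonglongrightarrow> 1 / (z - K z)"
      unfolding G_\<rho>[OF z] .
  next
    have "((\<lambda>y. 1 / (1 - 1 / \<i> * (K (\<i> * complex_of_real y) / complex_of_real y))) \<longlongrightarrow> 1 / (1 - 1 / \<i> * 0)) at_top"
      by (intro tendsto_intros vert) auto
    then have lim: "((\<lambda>y. 1 / (1 - 1 / \<i> * (K (\<i> * complex_of_real y) / complex_of_real y))) \<longlongrightarrow> 1) at_top"
      by simp
    show "((\<lambda>y. \<i> * complex_of_real y * (1 / (\<i> * complex_of_real y - K (\<i> * complex_of_real y)))) \<longlongrightarrow> 1) at_top"
    proof (rule Lim_transform_eventually[OF lim])
      show "\<forall>\<^sub>F y in at_top. 1 / (1 - 1 / \<i> * (K (\<i> * complex_of_real y) / complex_of_real y))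
         = \<i> * complex_of_real y * (1 / (\<i> * complex_of_real y - K (\<i> * complex_of_real y)))"
        using eventually_gt_at_top[of 0]
      proof eventually_elim
        case (elim y)
        have y0: "\<i> * complex_of_real y \<noteq> 0" using elim by simp
        have "\<i> * complex_of_real y * (1 - 1 / \<i> * (K (\<i> * complex_of_real y) / complex_of_real y))
          = \<i> * complex_of_real y - K (\<i> * complex_of_real y)"
          using elim by (simp add: field_simps)
        then show ?case using y0
          by (metis mult_divide_mult_cancel_left mult.right_neutral times_divide_eq_right)
      qed
    qed
  qed (rule that)
  show thesis
    by (rule that[OF M(1)]) (simp add: K_transform_def F_transform_def M(2))
qed

lemma vertical_limit_if_bounded:
  assumes "\<And>y. 1 \<le> y \<Longrightarrow> norm (K (\<i> * complex_of_real y)) \<le> c"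
  shows "((\<lambda>y. K (\<i> * complex_of_real y) / complex_of_real y) \<longlongrightarrow> 0) at_top"
proof (rule Lim_null_comparison)
  show "\<forall>\<^sub>F y in at_top. norm (K (\<i> * complex_of_real y) / complex_of_real y) \<le> c / y"
    using eventually_ge_at_top[of 1]
  proof eventually_elim
    case (elim y)
    then show ?case using assms[OF elim] by (simp add: norm_divide divide_right_mono)
  qed
  show "((\<lambda>y. c / y) \<longlongrightarrow> 0) at_top" by real_asymp
qed

subsection \<open>The matricial continued fraction\<close>

lemma lower_half_plane_step:
  fixes z w :: complex and b :: real
  assumes b: "0 \<le> b" and z: "0 < Im z" and w: "Im w \<le> 0"
  shows "Im (complex_of_real b / (z - w)) \<le> 0"
    and "norm (complex_of_real b / (z - w)) \<le> b / Im z"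
    and "z - w \<noteq> 0"
proof -
  show "Im (complex_of_real b / (z - w)) \<le> 0"
    using assms by (simp add: Im_divide divide_nonpos_nonneg mult_nonneg_nonneg mult_nonneg_nonpos)
  have "Im z \<le> norm (z - w)"
    using abs_Im_le_cmod[of "z - w"] z w by simp
  then show "norm (complex_of_real b / (z - w)) \<le> b / Im z"
    using b z by (simp add: norm_divide frac_le)
  show "z - w \<noteq> 0" using z w by (auto simp: complex_eq_iff)
qed

text \<open>Up to the factor \<open>D\<close>, the hypothesis and the conclusion bound the pseudo-hyperbolic distance of
  points of the lower half-plane: the step is a strict contraction for it, as its image stays away
  from the boundary.\<close>

lemma hyperbolic_contraction:
  fixes k k' :: "'r::finite \<Rightarrow> complex" and b D V :: real
  assumes b: "0 \<le> b" and z: "0 < Im z" and D: "0 \<le> D"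
    and k: "\<And>p. Im (k p) \<le> 0" and k': "\<And>p. Im (k' p) \<le> 0"
    and V: "- Im (\<Sum>p\<in>UNIV. k p) \<le> V" and V': "- Im (\<Sum>p\<in>UNIV. k' p) \<le> V"
    and dist: "\<And>p. (norm (k p - k' p))\<^sup>2 \<le> D * (Im (k p) * Im (k' p))"
  defines "f \<equiv> complex_of_real b / (z - (\<Sum>p\<in>UNIV. k p))"
    and "f' \<equiv> complex_of_real b / (z - (\<Sum>p\<in>UNIV. k' p))"
  shows "(norm (f - f'))\<^sup>2 \<le> (V / (Im z + V))\<^sup>2 * D * (Im f * Im f')"
proof -
  define w w' v v' where "w = (\<Sum>p\<in>UNIV. k p)" and "w' = (\<Sum>p\<in>UNIV. k' p)"
    and "v = - Im w" and "v' = - Im w'"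
  define q where "q = V / (Im z + V)"
  have v: "v = (\<Sum>p\<in>UNIV. - Im (k p))" and v': "v' = (\<Sum>p\<in>UNIV. - Im (k' p))"
    by (simp_all add: v_def v'_def w_def w'_def sum_negf)
  have v0: "0 \<le> v" "0 \<le> v'" unfolding v v' using k k' by (auto intro!: sum_nonneg)
  have vV: "v \<le> V" "v' \<le> V" using V V' by (simp_all add: v_def v'_def w_def w'_def)
  have q0: "0 \<le> q" unfolding q_def using v0 vV z by simp
  \<comment> \<open>The quotient \<open>u / (Im z + u)\<close> increases with \<open>u\<close>; this
    is where the gap \<open>Im z\<close> from the boundary becomes a factor below 1.\<close>
  have vq: "u \<le> q * (Im z + u)" if "0 \<le> u" "u \<le> V" for u
  proof -
    have "u * (Im z + V) \<le> V * (Im z + u)" using that z by (simp add: algebra_simps mult_right_mono)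
    then show ?thesis unfolding q_def using that z by (simp add: field_simps)
  qed
  have "norm (w - w') \<le> (\<Sum>p\<in>UNIV. norm (k p - k' p))"
    unfolding w_def w'_def by (simp add: norm_sum flip: sum_subtractf)
  also have "\<dots> \<le> (\<Sum>p\<in>UNIV. sqrt D * (sqrt (- Im (k p)) * sqrt (- Im (k' p))))"
  proof (rule sum_mono)
    fix p
    have "norm (k p - k' p) = sqrt ((norm (k p - k' p))\<^sup>2)" by simp
    also have "\<dots> \<le> sqrt (D * ((- Im (k p)) * (- Im (k' p))))"
      using dist[of p] by (intro real_sqrt_le_mono) simp
    also have "\<dots> = sqrt D * (sqrt (- Im (k p)) * sqrt (- Im (k' p)))"
      by (simp only: real_sqrt_mult)
    finally show "norm (k p - k' p) \<le> sqrt D * (sqrt (- Im (k p)) * sqrt (- Im (k' p)))" .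
  qed
  also have "\<dots> = sqrt D * (\<Sum>p\<in>UNIV. sqrt (- Im (k p)) * sqrt (- Im (k' p)))"
    by (rule sum_distrib_left[symmetric])
  finally have "(norm (w - w'))\<^sup>2 \<le> (sqrt D * (\<Sum>p\<in>UNIV. sqrt (- Im (k p)) * sqrt (- Im (k' p))))\<^sup>2"
    by (rule power_mono) simp
  also have "\<dots> = D * (\<Sum>p\<in>UNIV. sqrt (- Im (k p)) * sqrt (- Im (k' p)))\<^sup>2"
    using D by (simp add: power_mult_distrib)
  \<comment> \<open>Cauchy-Schwarz carries the bound from the summands to their sum without
    enlarging \<open>D\<close>.\<close>
  also have "\<dots> \<le> D * ((\<Sum>p\<in>UNIV. (sqrt (- Im (k p)))\<^sup>2) * (\<Sum>p\<in>UNIV. (sqrt (- Im (k' p)))\<^sup>2))"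
    by (intro mult_left_mono Cauchy_Schwarz_ineq_sum D)
  also have "\<dots> = D * (v * v')" using k k' by (simp add: v v')
  also have "\<dots> \<le> D * ((q * (Im z + v)) * (q * (Im z + v')))"
    by (intro mult_left_mono mult_mono vq v0 vV D mult_nonneg_nonneg q0) (use v0 z in auto)
  finally have ww: "(norm (w - w'))\<^sup>2 \<le> q\<^sup>2 * D * ((Im z + v) * (Im z + v'))"
    by (simp add: power2_eq_square algebra_simps)
  have nz: "z - w \<noteq> 0" "z - w' \<noteq> 0"
    using z v0 by (auto simp: v_def v'_def complex_eq_iff)
  define c where "c = b\<^sup>2 / ((norm (z - w))\<^sup>2 * (norm (z - w'))\<^sup>2)"
  have "f - f' = complex_of_real b * (w - w') / ((z - w) * (z - w'))"
    unfolding f_def f'_def w_def[symmetric] w'_def[symmetric] using nz by (simp add: field_simps)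
  then have "(norm (f - f'))\<^sup>2 = c * (norm (w - w'))\<^sup>2"
    by (simp add: c_def norm_mult norm_divide power_mult_distrib power_divide)
  also have "\<dots> \<le> c * (q\<^sup>2 * D * ((Im z + v) * (Im z + v')))"
    by (rule mult_left_mono[OF ww]) (simp add: c_def)
  also have "\<dots> = q\<^sup>2 * D * (c * ((Im z + v) * (Im z + v')))" by simp
  also have "c * ((Im z + v) * (Im z + v')) = Im f * Im f'"
  proof -
    have "Im (complex_of_real b / d) = - b * Im d / (norm d)\<^sup>2" for d
      by (simp add: Im_divide cmod_power2)
    then have "Im f = - b * (Im z + v) / (norm (z - w))\<^sup>2" "Im f' = - b * (Im z + v') / (norm (z - w'))\<^sup>2"
      unfolding f_def f'_def w_def[symmetric] w'_def[symmetric] v_def v'_def by simp_all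
    then show ?thesis by (simp add: c_def power2_eq_square)
  qed
  finally show ?thesis unfolding q_def .
qed

lemma contraction_factor:
  fixes y V :: real
  assumes "0 < y" "0 \<le> V"
  shows "0 \<le> V / (y + V)" "V / (y + V) < 1"
  using assms by simp_all

text \<open>The sum of all the ratios serves as \<open>D\<close>. An entry on the real line makes
  the divisor 0 and the ratio 0 by convention; the first assumption makes the two families agree
  there.\<close>

lemma hyperbolic_distance_finite:
  fixes k k' :: "'r::finite \<Rightarrow> 'r \<Rightarrow> complex"
  assumes "\<And>i j. k i j = k' i j \<or> (Im (k i j) < 0 \<and> Im (k' i j) < 0)"
    and "\<And>i j. Im (k i j) \<le> 0" "\<And>i j. Im (k' i j) \<le> 0"
  obtains D where "0 \<le> D" "\<And>i j. (norm (k i j - k' i j))\<^sup>2 \<le> D * (Im (k i j) * Im (k' i j))"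
proof
  let ?d = "\<lambda>i j. (norm (k i j - k' i j))\<^sup>2 / (Im (k i j) * Im (k' i j))"
  let ?D = "\<Sum>i\<in>UNIV. \<Sum>j\<in>UNIV. ?d i j"
  have d0: "0 \<le> ?d i j" for i j
    using assms(2,3) by (auto intro!: divide_nonneg_nonneg mult_nonpos_nonpos)
  then show "0 \<le> ?D" by (intro sum_nonneg)
  fix i j
  have "?d i j \<le> (\<Sum>j\<in>UNIV. ?d i j)" by (rule member_le_sum) (use d0 in auto)
  also have "\<dots> \<le> ?D" by (rule member_le_sum) (use d0 in \<open>auto intro: sum_nonneg\<close>)
  finally have dD: "?d i j \<le> ?D" .
  show "(norm (k i j - k' i j))\<^sup>2 \<le> ?D * (Im (k i j) * Im (k' i j))"
  proof (cases "k i j = k' i j")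
    case True
    then show ?thesis using \<open>0 \<le> ?D\<close> by simp
  next
    case False
    then have "0 < Im (k i j) * Im (k' i j)"
      using assms(1)[of i j] by (simp add: mult_neg_neg)
    then show ?thesis using dD by (simp add: pos_divide_le_eq)
  qed
qed

section \<open>Uniqueness of the fixed point in the lower half-plane\<close>

context
  fixes b :: "'r::finite \<Rightarrow> 'r \<Rightarrow> real" and z :: complex
  assumes b: "\<And>i j. 0 \<le> b i j" and z: "0 < Im z"
begin

text \<open>A common bound for how far any column sum can lie below the real axis, given the bounds
  \<open>b i j / Im z\<close> on the entries. It is the \<open>V\<close> of the contraction
  factor.\<close>

definition depth_bound :: real where
  "depth_bound = (\<Sum>i\<in>UNIV. \<Sum>j\<in>UNIV. b i j) / Im z"

lemma depth_bound_nonneg: "0 \<le> depth_bound"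
  unfolding depth_bound_def using b z by (auto intro!: divide_nonneg_pos sum_nonneg)

lemma column_sum_depth:
  assumes "\<And>i j. norm (k i j) \<le> b i j / Im z"
  shows "- Im (\<Sum>p\<in>UNIV. k p i) \<le> depth_bound"
proof -
  have "- Im (\<Sum>p\<in>UNIV. k p i) \<le> norm (\<Sum>p\<in>UNIV. k p i)"
    using abs_Im_le_cmod abs_le_D2 by blast
  also have "\<dots> \<le> (\<Sum>p\<in>UNIV. b p i / Im z)"
    by (intro sum_norm_le assms)
  also have "\<dots> \<le> (\<Sum>p\<in>UNIV. (\<Sum>j\<in>UNIV. b p j) / Im z)"
    using b z by (intro sum_mono divide_right_mono member_le_sum) auto
  also have "\<dots> = depth_bound" by (simp add: depth_bound_def sum_divide_distrib)
  finally show ?thesis .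
qed

text \<open>Both families are reproduced by the map, so their distance can be contracted any number
  of times and must vanish.\<close>

lemma continued_fraction_fixed_point_unique:
  assumes k: "\<And>i j. k i j = complex_of_real (b i j) / (z - (\<Sum>p\<in>UNIV. k p i))" "\<And>i j. Im (k i j) \<le> 0"
    and k': "\<And>i j. k' i j = complex_of_real (b i j) / (z - (\<Sum>p\<in>UNIV. k' p i))" "\<And>i j. Im (k' i j) \<le> 0"
  shows "k i j = k' i j"
proof -
  define q where "q = (depth_bound / (Im z + depth_bound))\<^sup>2"
  have q: "0 \<le> q" "q < 1"
    using contraction_factor[OF z depth_bound_nonneg] by (auto simp: q_def power_less_one_iff)
  have sums: "Im (\<Sum>p\<in>UNIV. k p i) \<le> 0" "Im (\<Sum>p\<in>UNIV. k' p i) \<le> 0" for i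
    using k(2) k'(2) by (auto intro!: sum_nonpos)
  have neg: "Im (complex_of_real (b i j) / (z - w)) < 0" if "b i j \<noteq> 0" "Im w \<le> 0" for i j w
    using that b[of i j] z lower_half_plane_step(3)[OF b z that(2)]
    by (simp add: Im_divide divide_neg_pos sum_power2_gt_zero_iff complex_eq_iff)
  \<comment> \<open>Where \<open>b i j = 0\<close> both entries are 0; elsewhere one application of
    the map has moved them off the real line, so the initial distance is finite.\<close>
  have "k i j = k' i j \<or> (Im (k i j) < 0 \<and> Im (k' i j) < 0)" for i j
    using neg[OF _ sums(1)[of i], of i j] neg[OF _ sums(2)[of i], of i j] k(1)[of i j] k'(1)[of i j]
    by (cases "b i j = 0") auto
  then obtain D where D: "0 \<le> D" "\<And>i j. (norm (k i j - k' i j))\<^sup>2 \<le> D * (Im (k i j) * Im (k' i j))"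
    using hyperbolic_distance_finite[of k k'] k(2) k'(2) by blast
  have bounds: "norm (k i j) \<le> b i j / Im z" "norm (k' i j) \<le> b i j / Im z" for i j
    unfolding k(1)[of i j] k'(1)[of i j] by (intro lower_half_plane_step(2) b z sums)+
  have iter: "(norm (k i j - k' i j))\<^sup>2 \<le> q ^ n * D * (Im (k i j) * Im (k' i j))" for n i j
  proof (induction n arbitrary: i j)
    case 0
    then show ?case using D(2) by simp
  next
    case (Suc n)
    have "(norm (k i j - k' i j))\<^sup>2 \<le> (depth_bound / (Im z + depth_bound))\<^sup>2 * (q ^ n * D) * (Im (k i j) * Im (k' i j))"
      unfolding k(1)[of i j] k'(1)[of i j]
      by (rule hyperbolic_contraction[OF b z])
         (use D q k(2) k'(2) Suc.IH column_sum_depth[OF bounds(1)] column_sum_depth[OF bounds(2)] in auto)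
    then show ?case by (simp add: q_def mult.assoc)
  qed
  have "(\<lambda>n. q ^ n * D * (Im (k i j) * Im (k' i j))) \<longlonglongrightarrow> 0 * D * (Im (k i j) * Im (k' i j))"
    by (intro tendsto_intros LIMSEQ_realpow_zero q)
  then have "(norm (k i j - k' i j))\<^sup>2 \<le> 0"
    using iter by (intro LIMSEQ_le_const[of "\<lambda>n. q ^ n * D * (Im (k i j) * Im (k' i j))"]) auto
  then show ?thesis by simp
qed

end

section \<open>Convergence and holomorphy of the continued fraction\<close>

lemma K_approx_bounds:
  fixes B :: "real^'r^'r"
  assumes B: "\<And>i j. 0 \<le> B $ i $ j" and z: "0 < Im z"
  shows "Im (K_approx B m i j z) \<le> 0 \<and> norm (K_approx B m i j z) \<le> B $ i $ j / Im z"
proof (induction m arbitrary: i j)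
  case 0
  then show ?case using lower_half_plane_step(1,2)[OF B z, of 0] by simp
next
  case (Suc m)
  have "Im (\<Sum>p\<in>UNIV. K_approx B m p i z) \<le> 0" using Suc.IH by (auto intro!: sum_nonpos)
  then show ?case using lower_half_plane_step(1,2)[OF B z] by simp
qed

lemma K_approx_holomorphic:
  fixes B :: "real^'r^'r"
  assumes B: "\<And>i j. 0 \<le> B $ i $ j"
  shows "K_approx B m i j holomorphic_on upper"
proof (induction m arbitrary: i j)
  case 0
  have "(\<lambda>z. complex_of_real (B $ i $ j) / z) holomorphic_on upper"
    by (intro holomorphic_intros) auto
  then show ?case by (rule holomorphic_transform) simp
next
  case (Suc m)
  have "(\<lambda>z. complex_of_real (B $ i $ j) / (z - (\<Sum>p\<in>UNIV. K_approx B m p i z))) holomorphic_on upper"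
  proof (intro holomorphic_intros Suc.IH)
    fix z :: complex assume z: "z \<in> upper"
    then have "Im (\<Sum>p\<in>UNIV. K_approx B m p i z) \<le> 0"
      using K_approx_bounds[OF B] by (auto intro!: sum_nonpos)
    then show "z - (\<Sum>p\<in>UNIV. K_approx B m p i z) \<noteq> 0"
      using z lower_half_plane_step(3)[of 0 z] by auto
  qed
  then show ?case by (rule holomorphic_transform) simp
qed

text \<open>Consecutive approximants are contracted like two fixed points would be: squared
  distances shrink by \<open>q^2\<close> per level, so the increments are dominated by a geometric
  series.\<close>

lemma K_approx_convergent:
  fixes B :: "real^'r^'r"
  assumes B: "\<And>i j. 0 \<le> B $ i $ j" and z: "0 < Im z"
  shows "convergent (\<lambda>m. K_approx B m i j z)"
proof -
  let ?b = "\<lambda>i j. B $ i $ j"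
  let ?k = "\<lambda>m i j. K_approx B m i j z"
  define V where "V = depth_bound ?b z"
  define q where "q = V / (Im z + V)"
  have V0: "0 \<le> V" unfolding V_def by (rule depth_bound_nonneg[OF B z])
  have q: "0 \<le> q" "q < 1"
    using contraction_factor[OF z V0] by (auto simp: q_def)
  note bd = K_approx_bounds[of B, OF B z]
  have depth: "- Im (\<Sum>p\<in>UNIV. ?k m p i) \<le> V" for m i
    unfolding V_def using bd by (intro column_sum_depth[OF B z]) auto
  have neg: "Im (complex_of_real (?b i j) / (z - w)) < 0" if "?b i j \<noteq> 0" "Im w \<le> 0" for i j w
    using that B[of i j] z lower_half_plane_step(3)[OF B z that(2)]
    by (simp add: Im_divide divide_neg_pos sum_power2_gt_zero_iff complex_eq_iff)
  have sums: "Im (\<Sum>p\<in>UNIV. ?k m p i) \<le> 0" for m i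
    using bd by (auto intro!: sum_nonpos)
  \<comment> \<open>The initial approximant \<open>b / z\<close> is itself a step of the fraction,
    from the value 0, so its nonzero entries already lie strictly below the real line.\<close>
  have "?k 1 i j = ?k 0 i j \<or> (Im (?k 1 i j) < 0 \<and> Im (?k 0 i j) < 0)" for i j
    using neg[OF _ sums[of 0 i], of i j] neg[of i j 0]
    by (cases "?b i j = 0") auto
  then obtain D where D: "0 \<le> D" "\<And>i j. (norm (?k 1 i j - ?k 0 i j))\<^sup>2 \<le> D * (Im (?k 1 i j) * Im (?k 0 i j))"
    using hyperbolic_distance_finite[of "?k 1" "?k 0"] bd by blast
  have iter: "(norm (?k (Suc m) i j - ?k m i j))\<^sup>2 \<le> (q\<^sup>2) ^ m * D * (Im (?k (Suc m) i j) * Im (?k m i j))" for m i j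
  proof (induction m arbitrary: i j)
    case 0
    then show ?case using D(2)[of i j] by simp
  next
    case (Suc m)
    have "(norm (?k (Suc (Suc m)) i j - ?k (Suc m) i j))\<^sup>2
       \<le> (V / (Im z + V))\<^sup>2 * ((q\<^sup>2) ^ m * D) * (Im (?k (Suc (Suc m)) i j) * Im (?k (Suc m) i j))"
      unfolding K_approx.simps(2)[of B "Suc m"] K_approx.simps(2)[of B m i j]
      by (rule hyperbolic_contraction[OF B z])
         (use D q bd Suc.IH depth in \<open>auto simp del: K_approx.simps\<close>)
    then show ?case by (simp add: q_def mult.assoc)
  qed
  define c where "c = ?b i j / Im z"
  have c0: "0 \<le> c" unfolding c_def using B z by simp
  \<comment> \<open>Back to the ordinary distance: both imaginary parts are at most \<open>c\<close>
    in absolute value, whatever the level.\<close>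
  have step: "norm (?k (Suc m) i j - ?k m i j) \<le> (sqrt D * c) * q ^ m" for m
  proof (rule power2_le_imp_le)
    have Im_le: "\<bar>Im (?k l i j)\<bar> \<le> c" for l
      using abs_Im_le_cmod[of "?k l i j"] bd[of l i j] by (simp add: c_def)
    have "\<bar>Im (?k (Suc m) i j)\<bar> * \<bar>Im (?k m i j)\<bar> \<le> c * c"
      by (intro mult_mono Im_le c0 abs_ge_zero)
    then have "Im (?k (Suc m) i j) * Im (?k m i j) \<le> c * c"
      by (rule order_trans[rotated]) (simp only: abs_mult[symmetric] abs_ge_self)
    then have "(q\<^sup>2) ^ m * D * (Im (?k (Suc m) i j) * Im (?k m i j)) \<le> (q\<^sup>2) ^ m * D * (c * c)"
      using D(1) q by (intro mult_left_mono) auto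
    also have "\<dots> = ((sqrt D * c) * q ^ m)\<^sup>2"
    proof -
      have "(q\<^sup>2) ^ m = (q ^ m)\<^sup>2" by (simp only: power_mult[symmetric] mult.commute)
      then show ?thesis
        by (simp only: power_mult_distrib real_sqrt_pow2[OF D(1)] power2_eq_square[of c] mult_ac)
    qed
    finally show "(norm (?k (Suc m) i j - ?k m i j))\<^sup>2 \<le> ((sqrt D * c) * q ^ m)\<^sup>2"
      using iter[of m i j] by linarith
    show "0 \<le> (sqrt D * c) * q ^ m" using D(1) c0 q by simp
  qed
  have "summable (\<lambda>m. (sqrt D * c) * q ^ m)"
    using q by (intro summable_mult summable_geometric) auto
  then have "summable (\<lambda>m. ?k (Suc m) i j - ?k m i j)"
    by (rule summable_comparison_test'[OF _ step])
  then have "convergent (\<lambda>n. \<Sum>m<n. ?k (Suc m) i j - ?k m i j)"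
    by (rule summable_iff_convergent[THEN iffD1])
  then have "convergent (\<lambda>n. ?k n i j - ?k 0 i j)"
    by (simp only: sum_lessThan_telescope[of "\<lambda>m. ?k m i j"])
  then have "convergent (\<lambda>n. (?k n i j - ?k 0 i j) + ?k 0 i j)"
    by (rule convergent_add) (rule convergent_const)
  then show ?thesis by simp
qed

context
  fixes B :: "real^'r^'r"
  assumes B: "\<And>i j. 0 \<le> B $ i $ j"
begin

lemma K_approx_tendsto:
  "0 < Im z \<Longrightarrow> (\<lambda>m. K_approx B m i j z) \<longlonglongrightarrow> K_fraction B i j z"
  unfolding K_fraction_def using K_approx_convergent[OF B] by (simp add: convergent_LIMSEQ_iff)

lemma Im_K_fraction_le: "0 < Im z \<Longrightarrow> Im (K_fraction B i j z) \<le> 0"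
  using K_approx_bounds[of B, OF B]
  by (intro LIMSEQ_le_const2[OF tendsto_Im[OF K_approx_tendsto]]) auto

lemma norm_K_fraction_le: "0 < Im z \<Longrightarrow> norm (K_fraction B i j z) \<le> B $ i $ j / Im z"
  using K_approx_bounds[of B, OF B]
  by (intro LIMSEQ_le_const2[OF tendsto_norm[OF K_approx_tendsto]]) auto

lemma K_fraction_fixed_point:
  assumes z: "0 < Im z"
  shows "K_fraction B i j z = complex_of_real (B $ i $ j) / (z - (\<Sum>p\<in>UNIV. K_fraction B p i z))"
proof (rule LIMSEQ_unique)
  show "(\<lambda>m. K_approx B (Suc m) i j z) \<longlonglongrightarrow> K_fraction B i j z"
    by (rule LIMSEQ_Suc[OF K_approx_tendsto[OF z]])
  have "Im (\<Sum>p\<in>UNIV. K_fraction B p i z) \<le> 0" using Im_K_fraction_le[OF z] by (auto intro!: sum_nonpos)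
  then show "(\<lambda>m. K_approx B (Suc m) i j z)
     \<longlonglongrightarrow> complex_of_real (B $ i $ j) / (z - (\<Sum>p\<in>UNIV. K_fraction B p i z))"
    unfolding K_approx.simps
    by (intro tendsto_intros K_approx_tendsto z lower_half_plane_step(3)[of 0 z]) (use z in auto)
qed

text \<open>The bound \<open>B $ i $ j / Im z\<close> makes the approximants a normal family. Since
  they converge pointwise, the holomorphic limit of a Montel subsequence is the fraction
  itself.\<close>

lemma K_fraction_holomorphic: "K_fraction B i j holomorphic_on upper"
proof -
  let ?H = "range (\<lambda>m. K_approx B m i j)"
  obtain g r where g: "g holomorphic_on upper" and r: "strict_mono r"
    and lim: "\<And>z. z \<in> upper \<Longrightarrow> (\<lambda>n. K_approx B (r n) i j z) \<longlonglongrightarrow> g z"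
  proof (rule Montel[of upper ?H "\<lambda>m. K_approx B m i j"])
    show "open upper" by (rule open_upper)
    show "h holomorphic_on upper" if "h \<in> ?H" for h using that K_approx_holomorphic[OF B] by auto
    fix K :: "complex set" assume K: "compact K" "K \<subseteq> upper"
    show "\<exists>c. \<forall>h\<in>?H. \<forall>z\<in>K. norm (h z) \<le> c"
    proof -
      have "compact ((\<lambda>z. B $ i $ j / Im z) ` K)"
        by (intro compact_continuous_image continuous_intros K) (use K in auto)
      then obtain c where c: "\<And>z. z \<in> K \<Longrightarrow> \<bar>B $ i $ j / Im z\<bar> \<le> c"
        using compact_imp_bounded by (fastforce simp: bounded_iff)
      have "norm (K_approx B m i j z) \<le> c" if "z \<in> K" for m z
      proof -
        have "norm (K_approx B m i j z) \<le> B $ i $ j / Im z"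
          using K_approx_bounds[of B, OF B, of z m i j] that K(2) by auto
        then show ?thesis using c[OF that] by linarith
      qed
      then show ?thesis by blast
    qed
  qed (auto intro: that)
  have "g z = K_fraction B i j z" if "z \<in> upper" for z
    using LIMSEQ_unique[OF lim[OF that]] LIMSEQ_subseq_LIMSEQ[OF K_approx_tendsto r, of z i j] that
    by (simp add: comp_def)
  then show ?thesis by (rule holomorphic_transform[OF g])
qed

end

subsection \<open>Existence of the measures\<close>

lemma fraction_measure_props:
  fixes B :: "real^'r^'r"
  assumes B: "\<And>i j. 0 \<le> B $ i $ j"
  shows "real_distribution (fraction_measure B i j)"
    and "\<And>z. 0 < Im z \<Longrightarrow> K_transform (fraction_measure B i j) z = K_fraction B i j z"
proof -
  obtain M where M: "real_distribution M" "\<And>z. 0 < Im z \<Longrightarrow> K_transform M z = K_fraction B i j z"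
  proof (rule K_transform_exists[of "K_fraction B i j"])
    show "K_fraction B i j holomorphic_on upper" by (rule K_fraction_holomorphic[OF B])
    show "Im (K_fraction B i j z) \<le> 0" if "0 < Im z" for z by (rule Im_K_fraction_le[OF B that])
    have "norm (K_fraction B i j (\<i> * complex_of_real y)) \<le> B $ i $ j" if "1 \<le> y" for y
    proof -
      have "norm (K_fraction B i j (\<i> * complex_of_real y)) \<le> B $ i $ j / y"
        using norm_K_fraction_le[of B "\<i> * complex_of_real y" i j, OF B] that by simp
      also have "\<dots> \<le> B $ i $ j / 1" using B that by (intro divide_left_mono) auto
      finally show ?thesis by simp
    qed
    then show "((\<lambda>y. K_fraction B i j (\<i> * complex_of_real y) / complex_of_real y) \<longlongrightarrow> 0) at_top"
      by (rule vertical_limit_if_bounded)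
  qed (rule that)
  have "real_distribution (fraction_measure B i j) \<and>
      (\<forall>z. 0 < Im z \<longrightarrow> K_transform (fraction_measure B i j) z = K_fraction B i j z)"
    unfolding fraction_measure_def
  proof (rule theI)
    fix N assume N: "real_distribution N \<and> (\<forall>z. 0 < Im z \<longrightarrow> K_transform N z = K_fraction B i j z)"
    then show "N = M" using M by (intro K_transform_unique) auto
  qed (use M in blast)
  then show "real_distribution (fraction_measure B i j)"
    and "\<And>z. 0 < Im z \<Longrightarrow> K_transform (fraction_measure B i j) z = K_fraction B i j z" by auto
qed

lemma boolean_compression_eqI:
  assumes "real_distribution \<rho>"
    and "\<And>z. 0 < Im z \<Longrightarrow> K_transform \<rho> z = complex_of_real t * K_transform \<mu> z"
  shows "boolean_compression t \<mu> = \<rho>"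
  unfolding boolean_compression_def
proof (rule the_equality)
  show "real_distribution \<rho> \<and> (\<forall>z. 0 < Im z \<longrightarrow> K_transform \<rho> z = complex_of_real t * K_transform \<mu> z)"
    using assms by blast
  fix N assume "real_distribution N \<and> (\<forall>z. 0 < Im z \<longrightarrow> K_transform N z = complex_of_real t * K_transform \<mu> z)"
  then show "N = \<rho>" using assms by (intro K_transform_unique) auto
qed

lemma boolean_compression_props:
  assumes \<mu>: "real_distribution \<mu>" and t: "0 \<le> t"
  shows "real_distribution (boolean_compression t \<mu>)"
    and "\<And>z. 0 < Im z \<Longrightarrow> K_transform (boolean_compression t \<mu>) z = complex_of_real t * K_transform \<mu> z"
proof -
  interpret real_distribution \<mu> by (rule \<mu>)
  obtain M where M: "real_distribution M" "\<And>z. 0 < Im z \<Longrightarrow> K_transform M z = complex_of_real t * K_transform \<mu> z"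
  proof (rule K_transform_exists[of "\<lambda>z. complex_of_real t * K_transform \<mu> z"])
    show "(\<lambda>z. complex_of_real t * K_transform \<mu> z) holomorphic_on upper"
      by (intro holomorphic_intros holomorphic_K_transform)
    show "Im (complex_of_real t * K_transform \<mu> z) \<le> 0" if "0 < Im z" for z
      using Im_K_transform_le[OF that] t by (simp add: mult_nonneg_nonpos)
    show "((\<lambda>y. complex_of_real t * K_transform \<mu> (\<i> * complex_of_real y) / complex_of_real y) \<longlongrightarrow> 0) at_top"
      using tendsto_mult_left[OF K_transform_vertical_limit, of "complex_of_real t"] by simp
  qed (rule that)
  then show "real_distribution (boolean_compression t \<mu>)"
    and "\<And>z. 0 < Im z \<Longrightarrow> K_transform (boolean_compression t \<mu>) z = complex_of_real t * K_transform \<mu> z"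
    using boolean_compression_eqI[OF M] by auto
qed

section \<open>Semicircle laws and their Boolean compressions\<close>

text \<open>The product of the real and imaginary parts of the root is \<open>Im z / 2\<close>, and
  the principal root has nonnegative real part. Two such roots of equal-height points multiply to a
  number in the upper half-plane, which fixes the branch for the semicircle.\<close>

lemma csqrt_upper:
  assumes "0 < Im z"
  shows "0 < Re (csqrt z)" "0 < Im (csqrt z)"
proof -
  have "(csqrt z)\<^sup>2 = z" by simp
  then have "2 * Re (csqrt z) * Im (csqrt z) = Im z"
    by (metis Im_power2)
  then have *: "0 < Re (csqrt z) * Im (csqrt z)" using assms by simp
  moreover have "0 \<le> Re (csqrt z)" by (rule csqrt_principal[THEN disjE, of z]) auto
  ultimately show "0 < Re (csqrt z)" "0 < Im (csqrt z)"
    by (auto simp: zero_less_mult_iff)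
qed

text \<open>With \<open>u, v\<close> the two values \<open>(z \<mp> R) / 2\<close> for the square root \<open>R\<close> of \<open>z\<^sup>2 - 4 \<alpha>\<^sup>2\<close>, one has
  \<open>u + v = z\<close> and \<open>u v = \<alpha>\<^sup>2\<close>, and \<open>v\<close> lies in the upper half-plane; hence \<open>u\<close> lies in the lower one.\<close>

lemma semicircle_props:
  assumes \<alpha>: "\<alpha> \<noteq> 0"
  shows "real_distribution (semicircle \<alpha>)"
    and "\<And>z. 0 < Im z \<Longrightarrow> K_transform (semicircle \<alpha>) z * (z - K_transform (semicircle \<alpha>) z) = complex_of_real (\<alpha>\<^sup>2)"
proof -
  define R where "R z = csqrt (z - complex_of_real (2 * \<alpha>)) * csqrt (z + complex_of_real (2 * \<alpha>))" for z
  define u where "u z = (z - R z) / 2" for z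
  have R2: "R z * R z = z * z - 4 * complex_of_real (\<alpha>\<^sup>2)" for z
  proof -
    have "R z * R z = (csqrt (z - complex_of_real (2 * \<alpha>)))\<^sup>2 * (csqrt (z + complex_of_real (2 * \<alpha>)))\<^sup>2"
      by (simp add: R_def power2_eq_square)
    then have "R z * R z = (z - complex_of_real (2 * \<alpha>)) * (z + complex_of_real (2 * \<alpha>))"
      unfolding power2_csqrt .
    also have "\<dots> = z * z - 4 * complex_of_real (\<alpha>\<^sup>2)" by (simp add: power2_eq_square algebra_simps)
    finally show ?thesis .
  qed
  have uv: "u z * (z - u z) = complex_of_real (\<alpha>\<^sup>2)" for z
    using R2[of z] by (simp add: u_def field_simps)
  have ImR: "0 < Im (R z)" if "0 < Im z" for z
    using csqrt_upper[of "z - complex_of_real (2 * \<alpha>)"] csqrt_upper[of "z + complex_of_real (2 * \<alpha>)"] that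
    by (simp add: R_def add_pos_pos)
  have v: "Im z / 2 < Im (z - u z)" if "0 < Im z" for z
    using ImR[OF that] by (simp add: u_def field_simps)
  have v0: "z - u z \<noteq> 0" if "0 < Im z" for z using v[OF that] that by auto
  have u_eq: "u z = complex_of_real (\<alpha>\<^sup>2) / (z - u z)" if "0 < Im z" for z
    using uv[of z] v0[OF that] by (simp add: field_simps)
  have Imu: "Im (u z) \<le> 0" if "0 < Im z" for z
    using v[OF that] that \<alpha> by (subst u_eq[OF that]) (simp add: Im_divide divide_nonpos_nonneg mult_nonneg_nonpos)
  have norm_u: "norm (u z) \<le> \<alpha>\<^sup>2 / Im z" if "0 < Im z" for z
    using lower_half_plane_step(2)[OF _ that Imu[OF that], of "\<alpha>\<^sup>2"] u_eq[OF that] by simp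
  have hol_csqrt: "(\<lambda>z. csqrt (z + c)) holomorphic_on upper" if "Im c = 0" for c
    by (rule holomorphic_on_compose_gen[OF _ holomorphic_on_csqrt, unfolded comp_def])
       (use that in \<open>auto intro!: holomorphic_intros simp: complex_nonpos_Reals_iff\<close>)
  have holR: "R holomorphic_on upper"
    unfolding R_def diff_conv_add_uminus
    by (intro holomorphic_on_mult hol_csqrt) auto
  obtain M where M: "real_distribution M" "\<And>z. 0 < Im z \<Longrightarrow> K_transform M z = u z"
  proof (rule K_transform_exists[of u])
    show "u holomorphic_on upper" unfolding u_def by (intro holomorphic_intros holR) auto
    have "norm (u (\<i> * complex_of_real y)) \<le> \<alpha>\<^sup>2" if "1 \<le> y" for y
    proof -
      have "norm (u (\<i> * complex_of_real y)) \<le> \<alpha>\<^sup>2 / y"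
        using norm_u[of "\<i> * complex_of_real y"] that by simp
      also have "\<dots> \<le> \<alpha>\<^sup>2 / 1" using that by (intro divide_left_mono) auto
      finally show ?thesis by simp
    qed
    then show "((\<lambda>y. u (\<i> * complex_of_real y) / complex_of_real y) \<longlongrightarrow> 0) at_top"
      by (rule vertical_limit_if_bounded)
  qed (use Imu in \<open>auto intro: that\<close>)
  interpret M: real_distribution M by (rule M(1))
  have G: "cauchy_transform M z = (z - R z) / complex_of_real (2 * \<alpha>\<^sup>2)" if "0 < Im z" for z
  proof -
    have "1 / cauchy_transform M z = z - u z"
      using M(2)[OF that] by (simp add: K_transform_def F_transform_def algebra_simps)
    then have "cauchy_transform M z = 1 / (z - u z)"
      by (metis div_by_1 divide_divide_eq_right mult_1)
    \<comment> \<open>By \<open>u v = \<alpha>\<^sup>2\<close> the reciprocal of \<open>v\<close> is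
      \<open>u / \<alpha>\<^sup>2\<close>, the formula that defines the semicircle law.\<close>
    also have "\<dots> = u z / complex_of_real (\<alpha>\<^sup>2)"
      using uv[of z] v0[OF that] \<alpha> by (simp add: field_simps)
    finally show ?thesis by (simp add: u_def)
  qed
  have "semicircle \<alpha> = M"
    unfolding semicircle_def R_def[symmetric]
  proof (rule the_equality)
    show "real_distribution M \<and> (\<forall>z. 0 < Im z \<longrightarrow> cauchy_transform M z = (z - R z) / complex_of_real (2 * \<alpha>\<^sup>2))"
      using M(1) G by blast
    fix N assume "real_distribution N \<and> (\<forall>z. 0 < Im z \<longrightarrow> cauchy_transform N z = (z - R z) / complex_of_real (2 * \<alpha>\<^sup>2))"
    then show "N = M" using M(1) G by (intro cauchy_transform_unique) auto
  qed
  then show "real_distribution (semicircle \<alpha>)"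
    and "\<And>z. 0 < Im z \<Longrightarrow> K_transform (semicircle \<alpha>) z * (z - K_transform (semicircle \<alpha>) z) = complex_of_real (\<alpha>\<^sup>2)"
    using M uv by auto
qed

lemma semicircle2_props:
  assumes \<alpha>: "\<alpha> \<noteq> 0" and \<beta>: "\<beta> \<noteq> 0"
  defines "t \<equiv> (\<beta> / \<alpha>)\<^sup>2"
  shows "real_distribution (semicircle2 \<alpha> \<beta>)"
    and "\<And>z. 0 < Im z \<Longrightarrow> K_transform (semicircle2 \<alpha> \<beta>) z * (z - K_transform (semicircle2 \<alpha> \<beta>) z / complex_of_real t)
      = complex_of_real (\<beta>\<^sup>2)"
proof -
  have t: "0 < t" unfolding t_def using assms by simp
  note sc = semicircle_props[OF \<alpha>]
  note bc = boolean_compression_props[OF sc(1) less_imp_le[OF t]]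
  show "real_distribution (semicircle2 \<alpha> \<beta>)"
    unfolding semicircle2_def using bc(1) by (simp add: t_def)
  fix z :: complex assume z: "0 < Im z"
  let ?u = "K_transform (semicircle \<alpha>) z"
  have "K_transform (semicircle2 \<alpha> \<beta>) z = complex_of_real t * ?u"
    unfolding semicircle2_def using bc(2)[OF z] by (simp add: t_def)
  then have "K_transform (semicircle2 \<alpha> \<beta>) z * (z - K_transform (semicircle2 \<alpha> \<beta>) z / complex_of_real t)
      = complex_of_real t * (?u * (z - ?u))"
    using t by simp
  also have "\<dots> = complex_of_real (t * \<alpha>\<^sup>2)" unfolding sc(2)[OF z] by simp
  also have "t * \<alpha>\<^sup>2 = \<beta>\<^sup>2" unfolding t_def using \<alpha> by (simp add: power_divide)
  finally show "K_transform (semicircle2 \<alpha> \<beta>) z * (z - K_transform (semicircle2 \<alpha> \<beta>) z / complex_of_real t)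
      = complex_of_real (\<beta>\<^sup>2)" .
qed

subsection \<open>Convolutions with Boolean compressions of semicircle laws\<close>

text \<open>The K-transform of the composition is \<open>K \<rho> + K \<nu>\<close> evaluated at
  \<open>F \<rho>\<close> in the second term. Since \<open>F \<rho>\<close> leaves the imaginary
  axis, the vertical limit for \<nu> does not apply there; the bound by \<open>c / Im z\<close>
  controls that term instead.\<close>

lemma monotone_conv_props:
  assumes \<nu>: "real_distribution \<nu>" and \<rho>: "real_distribution \<rho>"
    and bound: "\<And>z. 0 < Im z \<Longrightarrow> norm (K_transform \<nu> z) \<le> c / Im z"
  shows "real_distribution (monotone_conv \<nu> \<rho>)"
    and "\<And>z. 0 < Im z \<Longrightarrow> F_transform (monotone_conv \<nu> \<rho>) z = F_transform \<nu> (F_transform \<rho> z)"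
proof -
  interpret \<nu>: real_distribution \<nu> by (rule \<nu>)
  interpret \<rho>: real_distribution \<rho> by (rule \<rho>)
  let ?K = "\<lambda>z. K_transform \<rho> z + K_transform \<nu> (F_transform \<rho> z)"
  have F_upper: "0 < Im (F_transform \<rho> z)" if "0 < Im z" for z
    using \<rho>.Im_F_transform_ge[OF that] that by simp
  have c: "0 \<le> c"
    using order_trans[OF norm_ge_zero bound[of "\<i>"]] by simp
  obtain M where M: "real_distribution M" "\<And>z. 0 < Im z \<Longrightarrow> K_transform M z = ?K z"
  proof (rule K_transform_exists[of ?K])
    show "?K holomorphic_on upper"
      by (intro holomorphic_intros \<rho>.holomorphic_K_transform
          holomorphic_on_compose_gen[OF \<rho>.holomorphic_F_transform \<nu>.holomorphic_K_transform, unfolded comp_def])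
         (use F_upper in auto)
    show "Im (?K z) \<le> 0" if "0 < Im z" for z
      using \<rho>.Im_K_transform_le[OF that] \<nu>.Im_K_transform_le[OF F_upper[OF that]] by simp
    have "norm (K_transform \<nu> (F_transform \<rho> (\<i> * complex_of_real y))) \<le> c" if "1 \<le> y" for y
    proof -
      let ?w = "F_transform \<rho> (\<i> * complex_of_real y)"
      have w: "1 \<le> Im ?w" using \<rho>.Im_F_transform_ge[of "\<i> * complex_of_real y"] that by simp
      have "norm (K_transform \<nu> ?w) \<le> c / Im ?w" using w by (intro bound) simp
      also have "\<dots> \<le> c / 1" using w c by (intro divide_left_mono) auto
      finally show ?thesis by simp
    qed
    then have "((\<lambda>y. K_transform \<nu> (F_transform \<rho> (\<i> * complex_of_real y)) / complex_of_real y) \<longlongrightarrow> 0) at_top"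
      by (rule vertical_limit_if_bounded)
    from tendsto_add[OF \<rho>.K_transform_vertical_limit this]
    show "((\<lambda>y. ?K (\<i> * complex_of_real y) / complex_of_real y) \<longlongrightarrow> 0) at_top"
      by (simp add: add_divide_distrib)
  qed (rule that)
  have FM: "F_transform M z = F_transform \<nu> (F_transform \<rho> z)" if "0 < Im z" for z
    using M(2)[OF that] by (simp add: K_transform_def)
  have "real_distribution (monotone_conv \<nu> \<rho>) \<and>
      (\<forall>z. 0 < Im z \<longrightarrow> F_transform (monotone_conv \<nu> \<rho>) z = F_transform \<nu> (F_transform \<rho> z))"
    unfolding monotone_conv_def
  proof (rule theI)
    show "real_distribution M \<and> (\<forall>z. 0 < Im z \<longrightarrow> F_transform M z = F_transform \<nu> (F_transform \<rho> z))"
      using M(1) FM by blast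
    fix N assume "real_distribution N \<and> (\<forall>z. 0 < Im z \<longrightarrow> F_transform N z = F_transform \<nu> (F_transform \<rho> z))"
    then show "N = M" using M(1) FM by (intro K_transform_unique) (auto simp: K_transform_def)
  qed
  then show "real_distribution (monotone_conv \<nu> \<rho>)"
    and "\<And>z. 0 < Im z \<Longrightarrow> F_transform (monotone_conv \<nu> \<rho>) z = F_transform \<nu> (F_transform \<rho> z)" by auto
qed

section \<open>Inversion of F-transforms of compressed semicircle laws\<close>

text \<open>The quadratic equation is all that the convolutions use of a compressed semicircle law.
  For \<open>semicircle2 \<alpha> \<beta>\<close> one takes \<open>b = \<beta>\<^sup>2\<close> and
  \<open>t = (\<beta> / \<alpha>)\<^sup>2\<close>.\<close>

locale boolean_semicircle = real_distribution +
  fixes b t :: real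
  assumes b: "0 < b" and t: "0 < t"
    and K_quadratic: "\<And>z. 0 < Im z \<Longrightarrow> K_transform M z * (z - K_transform M z / complex_of_real t) = complex_of_real b"
begin

lemma norm_K_transform_le:
  assumes z: "0 < Im z"
  shows "norm (K_transform M z) \<le> b / Im z"
proof -
  have "Im (K_transform M z / complex_of_real t) \<le> 0"
    using Im_K_transform_le[OF z] t by (simp add: divide_nonpos_pos)
  note step = lower_half_plane_step(2,3)[OF less_imp_le[OF b] z this]
  have "K_transform M z = complex_of_real b / (z - K_transform M z / complex_of_real t)"
    using K_quadratic[OF z] step(2) by (simp add: nonzero_eq_divide_eq)
  then show ?thesis using step(1) by simp
qed

lemma F_transform_inverse_quadratic:
  assumes "0 < Im (z + \<phi>)" "F_transform M (z + \<phi>) = z"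
  shows "\<phi> * (z + \<phi> - \<phi> / complex_of_real t) = complex_of_real b"
    and "K_transform M (z + \<phi>) = \<phi>"
proof -
  show "K_transform M (z + \<phi>) = \<phi>" using assms(2) by (simp add: K_transform_def)
  then show "\<phi> * (z + \<phi> - \<phi> / complex_of_real t) = complex_of_real b"
    using K_quadratic[OF assms(1)] by simp
qed

text \<open>Subtracting the two quadratics leaves
  \<open>(\<phi> - \<psi>) (z + (1 - 1/t) (\<phi> + \<psi>)) = 0\<close>, and smallness excludes the
  second factor.\<close>

lemma F_transform_inverse_unique:
  assumes "0 < Im (z + \<phi>)" "F_transform M (z + \<phi>) = z"
    and "0 < Im (z + \<psi>)" "F_transform M (z + \<psi>) = z"
    and small: "\<bar>1 - 1 / t\<bar> * (norm \<phi> + norm \<psi>) < norm z"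
  shows "\<phi> = \<psi>"
proof (rule ccontr)
  assume ne: "\<phi> \<noteq> \<psi>"
  let ?r = "complex_of_real (1 - 1 / t)"
  have "\<phi> * (z + \<phi> - \<phi> / complex_of_real t) = \<psi> * (z + \<psi> - \<psi> / complex_of_real t)"
    using F_transform_inverse_quadratic(1)[OF assms(1,2)] F_transform_inverse_quadratic(1)[OF assms(3,4)] by simp
  then have "(\<phi> - \<psi>) * (z + ?r * (\<phi> + \<psi>)) = 0"
    by (simp add: algebra_simps diff_divide_distrib add_divide_distrib)
  then have "z = - (?r * (\<phi> + \<psi>))" using ne by (simp add: eq_neg_iff_add_eq_0)
  then have "norm z = \<bar>1 - 1 / t\<bar> * norm (\<phi> + \<psi>)"
    by (simp only: norm_minus_cancel norm_mult norm_of_real)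
  also have "\<dots> \<le> \<bar>1 - 1 / t\<bar> * (norm \<phi> + norm \<psi>)"
    by (intro mult_left_mono norm_triangle_ineq) simp
  finally show False using small by simp
qed

text \<open>The Voiculescu transform is the root \<open>\<phi>\<close> of \<open>(1 - 1/t) \<phi>\<^sup>2 + z \<phi> - b = 0\<close> which is small at infinity.\<close>

lemma F_transform_inverse_exists:
  obtains \<phi> M0 where "0 < M0" "\<phi> holomorphic_on {z. M0 < Im z}"
    "\<And>z. M0 < Im z \<Longrightarrow> norm (\<phi> z) \<le> 2 * b / norm z"
    "\<And>z. M0 < Im z \<Longrightarrow> 0 < Im (z + \<phi> z)"
    "\<And>z. M0 < Im z \<Longrightarrow> F_transform M (z + \<phi> z) = z"
proof
  \<comment> \<open>The discriminant is
    \<open>z^2 + 4 b (1 - 1/t) = z^2 (1 + \<kappa> / z^2)\<close>. Rationalising the small root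
    gives \<open>2 b / (z (1 + q))\<close>, a form that stays meaningful when
    \<open>t = 1\<close>.\<close>
  define \<kappa> where "\<kappa> = 4 * b * (1 - 1 / t)"
  \<comment> \<open>The terms serve separate purposes: \<open>\<bar>\<kappa>\<bar>\<close> keeps the
    radicand off the branch cut, \<open>2 b\<close> makes \<open>norm (\<phi> z) < 1\<close>, and
    \<open>(b + 1) / t\<close> excludes the other root below.\<close>
  define M0 where "M0 = 2 + \<bar>\<kappa>\<bar> + 2 * b + (b + 1) / t"
  define q where "q z = csqrt (1 + complex_of_real \<kappa> / z\<^sup>2)" for z
  define \<phi> where "\<phi> z = complex_of_real (2 * b) / (z * (1 + q z))" for z
  have M0: "2 + \<bar>\<kappa>\<bar> \<le> M0" "2 + 2 * b \<le> M0" "2 + (b + 1) / t \<le> M0"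
    using b t by (simp_all add: M0_def)
  show "0 < M0" using M0 by linarith
  have norm_z: "M0 < norm z" if "M0 < Im z" for z :: complex
    using that abs_Im_le_cmod[of z] by linarith
  have z0: "z \<noteq> 0" if "M0 < Im z" for z :: complex
    using norm_z[OF that] M0 by auto
  have dom: "0 < Re (1 + complex_of_real \<kappa> / z\<^sup>2)" if "M0 < Im z" for z
  proof -
    have "norm z * 1 \<le> norm z * norm z"
      using norm_z[OF that] M0 by (intro mult_left_mono) auto
    then have "\<bar>\<kappa>\<bar> < (norm z)\<^sup>2"
      using norm_z[OF that] M0(1) by (simp add: power2_eq_square)
    then have "norm (complex_of_real \<kappa> / z\<^sup>2) < 1"
      using z0[OF that] by (simp add: norm_divide norm_power divide_less_eq)
    then show ?thesis
      using abs_Re_le_cmod[of "complex_of_real \<kappa> / z\<^sup>2"] by simp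
  qed
  have q2: "q z * q z = 1 + complex_of_real \<kappa> / z\<^sup>2" for z
    by (simp add: q_def flip: power2_eq_square)
  have Re_q: "1 \<le> Re (1 + q z)" for z
    using Re_csqrt[of "1 + complex_of_real \<kappa> / z\<^sup>2"] by (simp add: q_def)
  have norm_q: "1 \<le> norm (1 + q z)" for z
    using Re_q[of z] complex_Re_le_cmod[of "1 + q z"] by linarith
  have q0: "1 + q z \<noteq> 0" for z using norm_q[of z] by auto
  show "\<phi> holomorphic_on {z. M0 < Im z}"
  proof -
    have "q holomorphic_on {z. M0 < Im z}"
      unfolding q_def
    proof (rule holomorphic_on_compose_gen[OF _ holomorphic_on_csqrt, unfolded comp_def])
      show "(\<lambda>z. 1 + complex_of_real \<kappa> / z\<^sup>2) holomorphic_on {z. M0 < Im z}"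
        by (intro holomorphic_intros) (use z0 in auto)
      show "(\<lambda>z. 1 + complex_of_real \<kappa> / z\<^sup>2) ` {z. M0 < Im z} \<subseteq> - \<real>\<^sub>\<le>\<^sub>0"
      proof (rule image_subsetI)
        fix z assume "z \<in> {z. M0 < Im z}"
        then show "1 + complex_of_real \<kappa> / z\<^sup>2 \<in> - \<real>\<^sub>\<le>\<^sub>0"
          using dom[of z] by (simp add: complex_nonpos_Reals_iff)
      qed
    qed
    then show ?thesis
      unfolding \<phi>_def by (intro holomorphic_intros) (use z0 q0 in auto)
  qed
  have bound: "norm (\<phi> z) \<le> 2 * b / norm z" if "M0 < Im z" for z
  proof -
    have "norm (\<phi> z) = 2 * b / (norm z * norm (1 + q z))"
      using b by (simp add: \<phi>_def norm_divide norm_mult)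
    also have "\<dots> \<le> 2 * b / (norm z * 1)"
      using b z0[OF that] norm_q[of z] by (intro divide_left_mono mult_left_mono mult_pos_pos) auto
    finally show ?thesis by simp
  qed
  then show "\<And>z. M0 < Im z \<Longrightarrow> norm (\<phi> z) \<le> 2 * b / norm z" .
  have norm1: "norm (\<phi> z) < 1" if "M0 < Im z" for z
  proof -
    have "2 * b / norm z < 1" using norm_z[OF that] M0(2) b by (simp add: divide_less_eq)
    then show ?thesis using bound[OF that] by linarith
  qed
  have Im_ge: "M0 - 1 < Im (z + \<phi> z)" if "M0 < Im z" for z
    using norm1[OF that] abs_Im_le_cmod[of "\<phi> z"] that by simp
  show "0 < Im (z + \<phi> z)" if "M0 < Im z" for z
    using Im_ge[OF that] M0(1) by linarith
  show "F_transform M (z + \<phi> z) = z" if z: "M0 < Im z" for z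
  proof -
    let ?r = "complex_of_real (1 / t)"
    define \<zeta> k where "\<zeta> = z + \<phi> z" and "k = K_transform M \<zeta>"
    have \<zeta>: "1 \<le> Im \<zeta>" "(b + 1) / t < norm \<zeta>"
      using Im_ge[OF z] M0 abs_Im_le_cmod[of \<zeta>] by (auto simp: \<zeta>_def)
    have quad: "\<phi> z * (\<zeta> - \<phi> z * ?r) = complex_of_real b"
    proof -
      define d where "d = z * (1 + q z)"
      have d0: "d \<noteq> 0" using z0[OF z] q0 by (simp add: d_def)
      have \<phi>d: "\<phi> z = complex_of_real (2 * b) / d" by (simp add: \<phi>_def d_def)
      have zq: "z * z * (q z * q z) = z * z + complex_of_real \<kappa>"
        unfolding q2 using z0[OF z] by (simp add: power2_eq_square field_simps)
      have "complex_of_real \<kappa> + 2 * z * d = d * d"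
        using zq by (simp add: d_def algebra_simps)
      moreover have "complex_of_real \<kappa> = 4 * complex_of_real b * (1 - ?r)" by (simp add: \<kappa>_def)
      ultimately have key: "4 * complex_of_real b * (1 - ?r) + 2 * z * d = d * d" by simp
      have "\<phi> z * (\<zeta> - \<phi> z * ?r) * (d * d) = complex_of_real b * (4 * complex_of_real b * (1 - ?r) + 2 * z * d)"
      proof -
        have "\<phi> z * d = 2 * complex_of_real b" using d0 by (simp add: \<phi>d)
        then have "(\<phi> z * d) * (z * d + (\<phi> z * d) * (1 - ?r))
          = 2 * complex_of_real b * (z * d + 2 * complex_of_real b * (1 - ?r))" by simp
        then show ?thesis by (simp add: \<zeta>_def algebra_simps)
      qed
      then have "\<phi> z * (\<zeta> - \<phi> z * ?r) * (d * d) = complex_of_real b * (d * d)" unfolding key .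
      then show ?thesis using d0 by simp
    qed
    have "k * (\<zeta> - k * ?r) = complex_of_real b"
      using K_quadratic[of \<zeta>] \<zeta>(1) by (simp add: k_def)
    with quad have "(k - \<phi> z) * (\<zeta> - (k + \<phi> z) * ?r) = 0"
      by (simp add: algebra_simps diff_divide_distrib)
    \<comment> \<open>If this factor vanished, \<open>k\<close> and \<open>\<phi> z\<close> would be
      the two different roots with sum \<open>t \<zeta>\<close> or a double root; both are too small
      for that.\<close>
    moreover have "\<zeta> - (k + \<phi> z) * ?r \<noteq> 0"
    proof
      assume "\<zeta> - (k + \<phi> z) * ?r = 0"
      then have "\<zeta> = (k + \<phi> z) * ?r" by simp
      then have "norm \<zeta> = norm (k + \<phi> z) / t"
        using t by (simp only: norm_mult norm_of_real) simp
      also have "\<dots> \<le> (b + 1) / t"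
      proof (rule divide_right_mono)
        have "norm k \<le> b / Im \<zeta>" unfolding k_def using \<zeta>(1) by (intro norm_K_transform_le) simp
        also have "\<dots> \<le> b / 1" using b \<zeta>(1) by (intro divide_left_mono) auto
        finally show "norm (k + \<phi> z) \<le> b + 1"
          using norm_triangle_ineq[of k "\<phi> z"] norm1[OF z] by simp
      qed (use t in simp)
      finally show False using \<zeta>(2) by simp
    qed
    ultimately have "k = \<phi> z" by simp
    then show ?thesis by (simp add: k_def \<zeta>_def K_transform_def)
  qed
qed

text \<open>\<open>F_transform M\<close> is injective far up, and F-transforms do not lower the
  imaginary part, so the two inner functions agree on a high half-plane and then everywhere by
  analytic continuation.\<close>

lemma monotone_conv_left_cancel:
  assumes \<rho>: "real_distribution \<rho>" and \<rho>': "real_distribution \<rho>'"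
    and eq: "\<And>z. 0 < Im z \<Longrightarrow> F_transform M (F_transform \<rho> z) = F_transform M (F_transform \<rho>' z)"
  shows "\<rho> = \<rho>'"
proof -
  interpret \<rho>: real_distribution \<rho> by (rule \<rho>)
  interpret \<rho>': real_distribution \<rho>' by (rule \<rho>')
  \<comment> \<open>Above height 1 the K-transform is bounded by \<open>b\<close>, so
    \<open>Y\<close> exceeds the left side of the smallness condition for two such values.\<close>
  define Y where "Y = 1 + \<bar>1 - 1 / t\<bar> * (2 * b)"
  have Y: "1 \<le> Y" using b by (simp add: Y_def)
  have inj: "w = w'" if w: "Y \<le> Im w" "Y \<le> Im w'" and F: "F_transform M w = F_transform M w'" for w w'
  proof -
    define z where "z = F_transform M w"
    have K_le: "norm (K_transform M v) \<le> b" if "Y \<le> Im v" for v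
    proof -
      have "norm (K_transform M v) \<le> b / Im v" using Y that by (intro norm_K_transform_le) simp
      also have "\<dots> \<le> b / 1" using b Y that by (intro divide_left_mono) auto
      finally show ?thesis by simp
    qed
    have sum: "z + K_transform M w = w" "z + K_transform M w' = w'"
      using F by (simp_all add: z_def K_transform_def)
    have "K_transform M w = K_transform M w'"
    proof (rule F_transform_inverse_unique[of z])
      have "Y \<le> norm z"
        using Im_F_transform_ge[of w] w(1) Y abs_Im_le_cmod[of z] by (simp add: z_def)
      moreover have "\<bar>1 - 1 / t\<bar> * (norm (K_transform M w) + norm (K_transform M w')) \<le> \<bar>1 - 1 / t\<bar> * (2 * b)"
        using K_le[OF w(1)] K_le[OF w(2)] by (intro mult_left_mono) auto
      ultimately show "\<bar>1 - 1 / t\<bar> * (norm (K_transform M w) + norm (K_transform M w')) < norm z"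
        by (simp add: Y_def)
      show "0 < Im (z + K_transform M w)" "0 < Im (z + K_transform M w')"
        unfolding sum using w Y by linarith+
      show "F_transform M (z + K_transform M w) = z" "F_transform M (z + K_transform M w') = z"
        unfolding sum using F by (simp_all add: z_def)
    qed
    then show ?thesis using sum by metis
  qed
  show ?thesis
  proof (rule K_transform_unique[OF \<rho> \<rho>'])
    fix z :: complex assume "0 < Im z"
    then have z: "z \<in> upper" by simp
    have "F_transform \<rho> z = F_transform \<rho>' z"
    proof (rule analytic_continuation_open[of "{z. Y < Im z}" upper, OF _ open_upper _ connected_upper _
        \<rho>.holomorphic_F_transform \<rho>'.holomorphic_F_transform _ z])
      show "open {z. Y < Im z}" by (rule open_halfspace_Im_gt)
      have "\<i> * complex_of_real (Y + 1) \<in> {z. Y < Im z}" by simp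
      then show "{z. Y < Im z} \<noteq> {}" by blast
      show "{z. Y < Im z} \<subseteq> upper" using Y by auto
      fix v assume "v \<in> {z. Y < Im z}"
      then have v: "Y < Im v" by simp
      show "F_transform \<rho> v = F_transform \<rho>' v"
        by (rule inj[OF _ _ eq])
           (use \<rho>.Im_F_transform_ge[of v] \<rho>'.Im_F_transform_ge[of v] v Y in auto)
    qed
    then show "K_transform \<rho> z = K_transform \<rho>' z" by (simp add: K_transform_def)
  qed
qed

end

section \<open>Uniqueness for the two-by-two system\<close>

lemma continued_fraction_pair_unique:
  assumes b: "0 < b" and c: "0 < c" and s: "0 < s" and t: "0 < t" and Z: "0 < Im Z"
    and A: "A * (Z - A / complex_of_real t - C) = complex_of_real b" "Im A \<le> 0"
    and C: "C * (Z - A - C / complex_of_real s) = complex_of_real c" "Im C \<le> 0"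
    and A': "A' * (Z - A' / complex_of_real t - C') = complex_of_real b" "Im A' \<le> 0"
    and C': "C' * (Z - A' - C' / complex_of_real s) = complex_of_real c" "Im C' \<le> 0"
  shows "A = A'" "C = C'"
proof -
  \<comment> \<open>Completes the pair to a matrix fixed point with rows \<open>(A / t, A)\<close>
    and \<open>(C, C / s)\<close>, whose column sums are what the two equations subtract from
    \<open>Z\<close>.\<close>
  define \<beta> :: "2 \<Rightarrow> 2 \<Rightarrow> real" where
    "\<beta> i j = (if i = 1 then (if j = 1 then b / t else b) else (if j = 1 then c else c / s))" for i j
  define k :: "complex \<Rightarrow> complex \<Rightarrow> 2 \<Rightarrow> 2 \<Rightarrow> complex" where
    "k A C i j = (if i = 1 then (if j = 1 then A / complex_of_real t else A)
       else (if j = 1 then C else C / complex_of_real s))" for A C i j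
  have two: "(2::2) \<noteq> 1" by simp
  have fixed: "k A C i j = complex_of_real (\<beta> i j) / (Z - (\<Sum>p\<in>UNIV. k A C p i))"
    if eqs: "A * (Z - A / complex_of_real t - C) = complex_of_real b"
      "C * (Z - A - C / complex_of_real s) = complex_of_real c" for A C i j
  proof -
    define d e where "d = Z - (A / complex_of_real t + C)" and "e = Z - (A + C / complex_of_real s)"
    have eqs': "A * d = complex_of_real b" "C * e = complex_of_real c"
      using eqs by (simp_all add: d_def e_def diff_diff_eq)
    then have nz: "d \<noteq> 0" "e \<noteq> 0" using b c by auto
    then have AC: "A = complex_of_real b / d" "C = complex_of_real c / e"
      using eqs' by (simp_all add: nonzero_eq_divide_eq)
    from AC have "A / complex_of_real t = complex_of_real (b / t) / d"
        "C / complex_of_real s = complex_of_real (c / s) / e"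
      by simp_all
    moreover note AC
    moreover have "Z - (\<Sum>p\<in>UNIV. k A C p i) = (if i = 1 then d else e)"
      using exhaust_2[of i] two by (auto simp: k_def sum_2 d_def e_def)
    ultimately show ?thesis
      using exhaust_2[of i] exhaust_2[of j] two by (auto simp: k_def \<beta>_def)
  qed
  have Im_k: "Im (k A C i j) \<le> 0" if "Im A \<le> 0" "Im C \<le> 0" for A C i j
    using that s t by (simp add: k_def divide_nonpos_pos)
  have "k A C i j = k A' C' i j" for i j
  proof (rule continued_fraction_fixed_point_unique[of \<beta> Z])
    show "0 \<le> \<beta> i j" for i j using b c s t by (simp add: \<beta>_def)
  qed (rule Z fixed[OF A(1) C(1)] fixed[OF A'(1) C'(1)] Im_k[OF A(2) C(2)] Im_k[OF A'(2) C'(2)])+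
  from this[of 1 2] this[of 2 1] show "A = A'" "C = C'"
    using two by (simp_all add: k_def)
qed

section \<open>Free convolution through right inverses on cones\<close>

lemma voiculescu_transform_onI:
  assumes "\<phi> holomorphic_on \<Gamma>"
    and "\<And>z. z \<in> \<Gamma> \<Longrightarrow> 0 < Im (z + \<phi> z)"
    and "\<And>z. z \<in> \<Gamma> \<Longrightarrow> F_transform \<mu> (z + \<phi> z) = z"
    and "((\<lambda>z. \<phi> z / z) \<longlongrightarrow> 0) (inf at_infinity (principal \<Gamma>))"
  shows "voiculescu_transform_on \<mu> \<Gamma> \<phi>"
  unfolding voiculescu_transform_on_def by (intro conjI ballI assms)

lemma voiculescu_transform_onD:
  assumes "voiculescu_transform_on \<mu> \<Gamma> \<phi>"
  shows "\<phi> holomorphic_on \<Gamma>"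
    and "z \<in> \<Gamma> \<Longrightarrow> 0 < Im (z + \<phi> z)"
    and "z \<in> \<Gamma> \<Longrightarrow> F_transform \<mu> (z + \<phi> z) = z"
  using assms unfolding voiculescu_transform_on_def by simp_all

lemma truncated_cone_tendsto_zero:
  assumes N: "1 \<le> N" and bound: "\<And>z. N < Im z \<Longrightarrow> norm (\<phi> z) \<le> c / norm z"
  shows "((\<lambda>z. \<phi> z / z) \<longlongrightarrow> 0) (inf at_infinity (principal (truncated_cone a N)))"
proof (rule Lim_null_comparison)
  show "\<forall>\<^sub>F z in inf at_infinity (principal (truncated_cone a N)). norm (\<phi> z / z) \<le> c * norm (inverse z)"
    unfolding eventually_inf_principal
  proof (intro always_eventually allI impI)
    fix z :: complex assume "z \<in> truncated_cone a N"
    then have z: "N < Im z" by (simp add: truncated_cone_def)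
    then have nz: "1 \<le> norm z" using N abs_Im_le_cmod[of z] by linarith
    have c: "0 \<le> c / norm z" by (rule order_trans[OF norm_ge_zero bound[OF z]])
    have "norm (\<phi> z / z) \<le> (c / norm z) / 1"
      unfolding norm_divide by (rule frac_le[OF c bound[OF z] _ nz]) simp
    then show "norm (\<phi> z / z) \<le> c * norm (inverse z)"
      by (simp add: norm_inverse divide_inverse)
  qed
  have "((\<lambda>z::complex. c * norm (inverse z)) \<longlongrightarrow> c * norm (0::complex)) at_infinity"
    by (intro tendsto_intros tendsto_inverse_0)
  then show "((\<lambda>z::complex. c * norm (inverse z)) \<longlongrightarrow> 0) (inf at_infinity (principal (truncated_cone a N)))"
    by (intro tendsto_mono[OF inf_le1]) simp
qed

text \<open>Points descending to \<open>z0\<close> on the imaginary axis are sent by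
  \<open>z + \<xi> z\<close> to points accumulating inside the half-plane, where both F-transforms
  agree. The identity theorem finishes.\<close>

lemma F_transform_eq_if_common_inverse:
  assumes \<rho>: "real_distribution \<rho>" and \<rho>': "real_distribution \<rho>'"
    and cont: "continuous_on (truncated_cone a N) \<xi>" and a: "0 < a" and N: "0 < N"
    and inv: "\<And>z. z \<in> truncated_cone a N \<Longrightarrow> 0 < Im (z + \<xi> z) \<and>
      F_transform \<rho> (z + \<xi> z) = z \<and> F_transform \<rho>' (z + \<xi> z) = z"
  shows "\<rho> = \<rho>'"
proof -
  interpret \<rho>: real_distribution \<rho> by (rule \<rho>)
  interpret \<rho>': real_distribution \<rho>' by (rule \<rho>')
  define z where "z n = \<i> * complex_of_real (N + 1 + 1 / real (Suc n))" for n
  define z0 where "z0 = \<i> * complex_of_real (N + 1)"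
  define w where "w v = v + \<xi> v" for v
  have z_cone: "z n \<in> truncated_cone a N" for n
    using a N by (simp add: z_def truncated_cone_def add_pos_pos del: of_nat_Suc)
  have z0_cone: "z0 \<in> truncated_cone a N"
    using a N by (simp add: z0_def truncated_cone_def)
  have "(\<lambda>n. N + 1 + 1 / real (Suc n)) \<longlonglongrightarrow> N + 1" by real_asymp
  then have z_lim: "z \<longlonglongrightarrow> z0"
    unfolding z_def z0_def by (intro tendsto_mult tendsto_const tendsto_of_real)
  have "(\<lambda>n. \<xi> (z n)) \<longlonglongrightarrow> \<xi> z0"
    by (rule continuous_on_tendsto_compose[OF cont z_lim z0_cone]) (simp add: z_cone)
  then have w_lim: "(\<lambda>n. w (z n)) \<longlonglongrightarrow> w z0"
    unfolding w_def by (intro tendsto_add z_lim)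
  \<comment> \<open>\<open>F_transform \<rho>\<close> recovers the argument of \<open>w\<close>, so
    \<open>w\<close> is injective on the cone and the limit is a genuine accumulation point.\<close>
  have "w (z n) \<noteq> w z0" for n
  proof
    assume "w (z n) = w z0"
    then have "z n = z0" using inv[OF z_cone[of n]] inv[OF z0_cone] by (metis w_def)
    then show False by (simp add: z_def z0_def del: of_nat_Suc)
  qed
  then have limpt: "w z0 islimpt range (\<lambda>n. w (z n))"
    unfolding islimpt_sequential using w_lim by (intro exI[of _ "\<lambda>n. w (z n)"]) auto
  have "F_transform \<rho> v - F_transform \<rho>' v = 0" if v: "v \<in> upper" for v
  proof (rule analytic_continuation[of "\<lambda>v. F_transform \<rho> v - F_transform \<rho>' v" upper "range (\<lambda>n. w (z n))" "w z0",
      OF _ open_upper connected_upper _ _ limpt _ v])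
    show "(\<lambda>v. F_transform \<rho> v - F_transform \<rho>' v) holomorphic_on upper"
      by (intro holomorphic_intros \<rho>.holomorphic_F_transform \<rho>'.holomorphic_F_transform)
    show "range (\<lambda>n. w (z n)) \<subseteq> upper" using inv z_cone by (auto simp: w_def)
    show "w z0 \<in> upper" using inv[OF z0_cone] by (simp add: w_def)
    show "F_transform \<rho> u - F_transform \<rho>' u = 0" if "u \<in> range (\<lambda>n. w (z n))" for u
      using that inv z_cone by (auto simp: w_def)
  qed
  then show ?thesis
    by (intro K_transform_unique[OF \<rho> \<rho>']) (simp add: K_transform_def)
qed

lemma free_conv_eqI:
  assumes \<mu>: "boolean_semicircle \<mu> b t" and \<nu>: "boolean_semicircle \<nu> c s"
    and \<rho>: "real_distribution \<rho>"
    and A: "\<And>z. 0 < Im z \<Longrightarrow> A z * (z - A z / complex_of_real t - C z) = complex_of_real b"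
      "\<And>z. 0 < Im z \<Longrightarrow> Im (A z) \<le> 0"
    and C: "\<And>z. 0 < Im z \<Longrightarrow> C z * (z - A z - C z / complex_of_real s) = complex_of_real c"
      "\<And>z. 0 < Im z \<Longrightarrow> Im (C z) \<le> 0"
    and F\<rho>: "\<And>z. 0 < Im z \<Longrightarrow> F_transform \<rho> z = z - A z - C z"
  shows "free_conv \<mu> \<nu> = \<rho>"
proof -
  interpret \<mu>: boolean_semicircle \<mu> b t by (rule \<mu>)
  interpret \<nu>: boolean_semicircle \<nu> c s by (rule \<nu>)
  \<comment> \<open>At \<open>?Z\<close> the pair \<open>\<phi>\<close>, \<open>\<psi>\<close>
    solves the system that \<open>A ?Z\<close>, \<open>C ?Z\<close> solve, with the same signs, so
    the pairs coincide. No assumption on how \<open>\<phi>\<close> and \<open>\<psi>\<close> arose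
    enters, hence the use for existence as well as for uniqueness.\<close>
  have inverse_add: "F_transform \<rho> (z + (\<phi> + \<psi>)) = z"
    if \<phi>: "0 < Im (z + \<phi>)" "F_transform \<mu> (z + \<phi>) = z"
      and \<psi>: "0 < Im (z + \<psi>)" "F_transform \<nu> (z + \<psi>) = z"
      and Z: "0 < Im (z + (\<phi> + \<psi>))" for z \<phi> \<psi>
  proof -
    let ?Z = "z + (\<phi> + \<psi>)"
    have eq: "\<phi> * (?Z - \<phi> / complex_of_real t - \<psi>) = complex_of_real b"
      "\<psi> * (?Z - \<phi> - \<psi> / complex_of_real s) = complex_of_real c"
      using \<mu>.F_transform_inverse_quadratic(1)[OF \<phi>] \<nu>.F_transform_inverse_quadratic(1)[OF \<psi>]
      by (simp_all add: algebra_simps)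
    have Im: "Im \<phi> \<le> 0" "Im \<psi> \<le> 0"
      using \<mu>.Im_K_transform_le[OF \<phi>(1)] \<nu>.Im_K_transform_le[OF \<psi>(1)]
        \<mu>.F_transform_inverse_quadratic(2)[OF \<phi>] \<nu>.F_transform_inverse_quadratic(2)[OF \<psi>] by simp_all
    have "A ?Z = \<phi>" "C ?Z = \<psi>"
      using continued_fraction_pair_unique[OF \<mu>.b \<nu>.b \<nu>.t \<mu>.t Z A(1)[OF Z] A(2)[OF Z]
        C(1)[OF Z] C(2)[OF Z] eq(1) Im(1) eq(2) Im(2)] by auto
    then show ?thesis using F\<rho>[OF Z] by simp
  qed
  show ?thesis
    unfolding free_conv_def
  proof (rule the_equality, intro conjI \<rho>)
    obtain \<phi> M1 where \<phi>: "0 < M1" "\<phi> holomorphic_on {z. M1 < Im z}"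
      "\<And>z. M1 < Im z \<Longrightarrow> norm (\<phi> z) \<le> 2 * b / norm z"
      "\<And>z. M1 < Im z \<Longrightarrow> 0 < Im (z + \<phi> z)"
      "\<And>z. M1 < Im z \<Longrightarrow> F_transform \<mu> (z + \<phi> z) = z"
      by (rule \<mu>.F_transform_inverse_exists) (rule that)
    obtain \<psi> M2 where \<psi>: "0 < M2" "\<psi> holomorphic_on {z. M2 < Im z}"
      "\<And>z. M2 < Im z \<Longrightarrow> norm (\<psi> z) \<le> 2 * c / norm z"
      "\<And>z. M2 < Im z \<Longrightarrow> 0 < Im (z + \<psi> z)"
      "\<And>z. M2 < Im z \<Longrightarrow> F_transform \<nu> (z + \<psi> z) = z"
      by (rule \<nu>.F_transform_inverse_exists) (rule that)
    \<comment> \<open>Above \<open>M1\<close> and \<open>M2\<close> both inverses exist;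
      \<open>2 * b + 2 * c\<close> makes their sum smaller than 1 in modulus, so that the shifted
      point stays in the upper half-plane.\<close>
    define N where "N = M1 + M2 + 2 * b + 2 * c + 1"
    have N: "M1 \<le> N" "M2 \<le> N" "1 \<le> N" "2 * b + 2 * c \<le> N"
      using \<phi>(1) \<psi>(1) \<mu>.b \<nu>.b by (simp_all add: N_def)
    let ?\<Gamma> = "truncated_cone 1 N"
    have cone: "N < Im z" if "z \<in> ?\<Gamma>" for z using that by (simp add: truncated_cone_def)
    have sub: "?\<Gamma> \<subseteq> {z. M1 < Im z}" "?\<Gamma> \<subseteq> {z. M2 < Im z}"
      using cone N by force+
    have lim: "((\<lambda>z. \<phi> z / z) \<longlongrightarrow> 0) (inf at_infinity (principal ?\<Gamma>))"
      "((\<lambda>z. \<psi> z / z) \<longlongrightarrow> 0) (inf at_infinity (principal ?\<Gamma>))"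
      by (rule truncated_cone_tendsto_zero[OF N(3) \<phi>(3)], use N in simp)
         (rule truncated_cone_tendsto_zero[OF N(3) \<psi>(3)], use N in simp)
    have Im_sum: "0 < Im (z + (\<phi> z + \<psi> z))" if "z \<in> ?\<Gamma>" for z
    proof -
      have z: "N < Im z" by (rule cone[OF that])
      have nz: "N < norm z" using z abs_Im_le_cmod[of z] by linarith
      have "norm (\<phi> z + \<psi> z) \<le> 2 * b / norm z + 2 * c / norm z"
        using \<phi>(3)[of z] \<psi>(3)[of z] z N by (intro norm_triangle_le add_mono) auto
      also have "\<dots> < 1"
        using nz N by (simp add: divide_less_eq flip: add_divide_distrib)
      finally show ?thesis
        using abs_Im_le_cmod[of "\<phi> z + \<psi> z"] z N(3) by simp
    qed
    have "voiculescu_transform_on \<mu> ?\<Gamma> \<phi>"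
      by (rule voiculescu_transform_onI[OF holomorphic_on_subset[OF \<phi>(2) sub(1)] \<phi>(4,5) lim(1)])
         (use sub in auto)
    moreover have "voiculescu_transform_on \<nu> ?\<Gamma> \<psi>"
      by (rule voiculescu_transform_onI[OF holomorphic_on_subset[OF \<psi>(2) sub(2)] \<psi>(4,5) lim(2)])
         (use sub in auto)
    moreover have "voiculescu_transform_on \<rho> ?\<Gamma> (\<lambda>z. \<phi> z + \<psi> z)"
    proof (rule voiculescu_transform_onI)
      show "(\<lambda>z. \<phi> z + \<psi> z) holomorphic_on ?\<Gamma>"
        by (intro holomorphic_intros holomorphic_on_subset[OF \<phi>(2) sub(1)] holomorphic_on_subset[OF \<psi>(2) sub(2)])
      show "((\<lambda>z. (\<phi> z + \<psi> z) / z) \<longlongrightarrow> 0) (inf at_infinity (principal ?\<Gamma>))"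
        using tendsto_add[OF lim] by (simp add: add_divide_distrib)
      fix z assume z: "z \<in> ?\<Gamma>"
      then have Mz: "M1 < Im z" "M2 < Im z" using sub by auto
      show "0 < Im (z + (\<phi> z + \<psi> z))" by (rule Im_sum[OF z])
      show "F_transform \<rho> (z + (\<phi> z + \<psi> z)) = z"
        by (rule inverse_add[OF \<phi>(4,5)[OF Mz(1)] \<psi>(4,5)[OF Mz(2)] Im_sum[OF z]])
    qed
    ultimately show "\<exists>a>0. \<exists>M>0. \<exists>\<phi> \<psi>. voiculescu_transform_on \<mu> (truncated_cone a M) \<phi> \<and>
        voiculescu_transform_on \<nu> (truncated_cone a M) \<psi> \<and>
        voiculescu_transform_on \<rho> (truncated_cone a M) (\<lambda>z. \<phi> z + \<psi> z)"
      using zero_less_one[where 'a = real] less_le_trans[OF zero_less_one N(3)] by blast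
  next
    \<comment> \<open>A competitor brings its own cone and inverses; \<open>inverse_add\<close>
      shows that their sum inverts \<open>F_transform \<rho>\<close> as well.\<close>
    fix \<rho>' assume *: "real_distribution \<rho>' \<and> (\<exists>a>0. \<exists>M>0. \<exists>\<phi> \<psi>.
        voiculescu_transform_on \<mu> (truncated_cone a M) \<phi> \<and>
        voiculescu_transform_on \<nu> (truncated_cone a M) \<psi> \<and>
        voiculescu_transform_on \<rho>' (truncated_cone a M) (\<lambda>z. \<phi> z + \<psi> z))"
    then obtain a N \<phi> \<psi> where aN: "0 < a" "0 < N"
      and \<phi>: "voiculescu_transform_on \<mu> (truncated_cone a N) \<phi>"
      and \<psi>: "voiculescu_transform_on \<nu> (truncated_cone a N) \<psi>"
      and \<rho>'V: "voiculescu_transform_on \<rho>' (truncated_cone a N) (\<lambda>z. \<phi> z + \<psi> z)"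
      by blast
    show "\<rho>' = \<rho>"
    proof (rule F_transform_eq_if_common_inverse[of _ _ a N "\<lambda>z. \<phi> z + \<psi> z"])
      show "real_distribution \<rho>'" using * by blast
      show "continuous_on (truncated_cone a N) (\<lambda>z. \<phi> z + \<psi> z)"
        by (rule holomorphic_on_imp_continuous_on[OF voiculescu_transform_onD(1)[OF \<rho>'V]])
      fix z assume z: "z \<in> truncated_cone a N"
      have "0 < Im (z + (\<phi> z + \<psi> z))" "F_transform \<rho>' (z + (\<phi> z + \<psi> z)) = z"
        by (rule voiculescu_transform_onD(2,3)[OF \<rho>'V z])+
      moreover have "F_transform \<rho> (z + (\<phi> z + \<psi> z)) = z"
        by (rule inverse_add[OF voiculescu_transform_onD(2,3)[OF \<phi> z]
              voiculescu_transform_onD(2,3)[OF \<psi> z] voiculescu_transform_onD(2)[OF \<rho>'V z]])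
      ultimately show "0 < Im (z + (\<phi> z + \<psi> z)) \<and> F_transform \<rho>' (z + (\<phi> z + \<psi> z)) = z \<and>
          F_transform \<rho> (z + (\<phi> z + \<psi> z)) = z" by blast
    qed (use \<rho> aN in auto)
  qed
qed

text \<open>The pair \<open>A, C\<close> solves the continued fraction system. Both \<open>\<nu> \<boxplus> \<mu>\<close> and \<open>\<nu> \<rhd> \<rho>\<close> then have the
  F-transform \<open>z - A z - C z\<close>, since \<open>C z = K\<^sub>\<nu> (z - A z)\<close>.\<close>

lemma s_free_conv_eqI:
  assumes \<mu>: "boolean_semicircle \<mu> b t" and \<nu>: "boolean_semicircle \<nu> c s"
    and \<rho>: "real_distribution \<rho>" and K\<rho>: "\<And>z. 0 < Im z \<Longrightarrow> K_transform \<rho> z = A z"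
    and A: "\<And>z. 0 < Im z \<Longrightarrow> A z * (z - A z / complex_of_real t - C z) = complex_of_real b"
    and C: "\<And>z. 0 < Im z \<Longrightarrow> C z * (z - A z - C z / complex_of_real s) = complex_of_real c"
      "\<And>z. 0 < Im z \<Longrightarrow> Im (C z) \<le> 0"
  shows "s_free_conv \<mu> \<nu> = \<rho>"
proof -
  interpret \<mu>: boolean_semicircle \<mu> b t by (rule \<mu>)
  interpret \<nu>: boolean_semicircle \<nu> c s by (rule \<nu>)
  interpret \<rho>: real_distribution \<rho> by (rule \<rho>)
  have mc: "real_distribution (monotone_conv \<nu> \<tau>)"
      "0 < Im z \<Longrightarrow> F_transform (monotone_conv \<nu> \<tau>) z = F_transform \<nu> (F_transform \<tau> z)"
    if "real_distribution \<tau>" for \<tau> z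
    using monotone_conv_props[OF \<nu>.real_distribution_axioms that, of c] \<nu>.norm_K_transform_le by auto
  have ImA: "Im (A z) \<le> 0" if "0 < Im z" for z
    using \<rho>.Im_K_transform_le[OF that] K\<rho>[OF that] by simp
  have F: "F_transform (monotone_conv \<nu> \<rho>) z = z - C z - A z" if z: "0 < Im z" for z
  proof -
    define \<zeta> k where "\<zeta> = z - A z" and "k = K_transform \<nu> \<zeta>"
    have \<zeta>: "0 < Im \<zeta>" using ImA[OF z] z by (simp add: \<zeta>_def)
    have "k * (\<zeta> - k / complex_of_real s) = complex_of_real c"
      unfolding k_def by (rule \<nu>.K_quadratic[OF \<zeta>])
    moreover have "C z * (\<zeta> - C z / complex_of_real s) = complex_of_real c"
      unfolding \<zeta>_def by (rule C(1)[OF z])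
    ultimately have "(k - C z) * (\<zeta> - (k + C z) / complex_of_real s) = 0"
      by (simp add: algebra_simps add_divide_distrib diff_divide_distrib)
    \<comment> \<open>Sign argument: the right-hand side has nonpositive imaginary part, while
      \<open>\<zeta>\<close> lies in the upper half-plane.\<close>
    moreover have "\<zeta> \<noteq> (k + C z) / complex_of_real s"
    proof
      assume "\<zeta> = (k + C z) / complex_of_real s"
      then have "Im \<zeta> = (Im k + Im (C z)) / s" by simp
      moreover have "Im k + Im (C z) \<le> 0"
        using \<nu>.Im_K_transform_le[OF \<zeta>] C(2)[OF z] by (simp add: k_def)
      ultimately show False using \<zeta> \<nu>.t by (simp add: zero_less_divide_iff)
    qed
    ultimately have k: "k = C z" by simp
    have F\<rho>: "F_transform \<rho> z = \<zeta>"
      using K\<rho>[OF z] by (simp add: K_transform_def \<zeta>_def algebra_simps)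
    have F\<nu>: "F_transform \<nu> \<zeta> = \<zeta> - k" by (simp add: k_def K_transform_def)
    show ?thesis
      unfolding mc(2)[OF \<rho> z] F\<rho> F\<nu> k by (simp add: \<zeta>_def)
  qed
  have free: "free_conv \<nu> \<mu> = monotone_conv \<nu> \<rho>"
  proof (rule free_conv_eqI[OF \<nu> \<mu> mc(1)[OF \<rho>] _ _ _ _ F])
    fix z :: complex assume z: "0 < Im z"
    show "C z * (z - C z / complex_of_real s - A z) = complex_of_real c"
      using C(1)[OF z] by (simp add: algebra_simps)
    show "A z * (z - C z - A z / complex_of_real t) = complex_of_real b"
      using A[OF z] by (simp add: algebra_simps)
  qed (use C(2) ImA in auto)
  show ?thesis
    unfolding s_free_conv_def
  proof (rule the_equality)
    show "real_distribution \<rho> \<and> free_conv \<nu> \<mu> = monotone_conv \<nu> \<rho>" using \<rho> free by blast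
    fix \<rho>' assume "real_distribution \<rho>' \<and> free_conv \<nu> \<mu> = monotone_conv \<nu> \<rho>'"
    then have \<rho>': "real_distribution \<rho>'" and eq: "monotone_conv \<nu> \<rho>' = monotone_conv \<nu> \<rho>"
      using free by auto
    show "\<rho>' = \<rho>"
    proof (rule \<nu>.monotone_conv_left_cancel[OF \<rho>' \<rho>])
      fix z :: complex assume z: "0 < Im z"
      show "F_transform \<nu> (F_transform \<rho>' z) = F_transform \<nu> (F_transform \<rho> z)"
        using mc(2)[OF \<rho>' z] mc(2)[OF \<rho> z] eq by simp
    qed
  qed
qed

section \<open>The continued fraction as an s-free convolution\<close>

lemma boolean_semicircle_semicircle2:
  assumes "\<alpha> \<noteq> 0" "\<beta> \<noteq> 0"
  shows "boolean_semicircle (semicircle2 \<alpha> \<beta>) (\<beta>\<^sup>2) ((\<beta> / \<alpha>)\<^sup>2)"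
  using semicircle2_props[OF assms] assms
  by (intro boolean_semicircle.intro boolean_semicircle_axioms.intro) auto

lemma K_fraction_mult_denominator:
  fixes B :: "real^2^2"
  assumes B: "\<And>i j. 0 \<le> B $ i $ j" and z: "0 < Im z"
  shows "K_fraction B i j z * (z - K_fraction B 1 i z - K_fraction B 2 i z) = complex_of_real (B $ i $ j)"
proof -
  have "Im (K_fraction B 1 i z + K_fraction B 2 i z) \<le> 0"
    using Im_K_fraction_le[OF B z, of 1 i] Im_K_fraction_le[OF B z, of 2 i] by simp
  then have "z - (K_fraction B 1 i z + K_fraction B 2 i z) \<noteq> 0"
    by (rule lower_half_plane_step(3)[OF order_refl z])
  then have "K_fraction B i j z * (z - (K_fraction B 1 i z + K_fraction B 2 i z)) = complex_of_real (B $ i $ j)"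
    using K_fraction_fixed_point[OF B z, of i j] by (simp add: sum_2 nonzero_eq_divide_eq)
  then show ?thesis by (simp only: diff_diff_eq)
qed

text \<open>All entries of row \<open>i\<close> share the denominator, which involves only column
  \<open>i\<close> of the fraction.\<close>

lemma K_fraction_row_proportional:
  fixes B :: "real^'r^'r"
  assumes B: "\<And>i j. 0 \<le> B $ i $ j" and z: "0 < Im z" and nz: "B $ i $ k \<noteq> 0"
  shows "K_fraction B i j z = complex_of_real (B $ i $ j / B $ i $ k) * K_fraction B i k z"
  unfolding K_fraction_fixed_point[OF B z, of i j] K_fraction_fixed_point[OF B z, of i k]
  using nz by simp

theorem theorem8p1:
  fixes B :: "real^2^2" and \<alpha> \<beta> \<gamma> \<delta> s t :: real
  assumes nonneg: "\<And>i j. 0 \<le> B $ i $ j"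
    and "\<alpha> = sqrt (B $ 1 $ 1)" and "\<beta> = sqrt (B $ 1 $ 2)"
    and "\<gamma> = sqrt (B $ 2 $ 1)" and "\<delta> = sqrt (B $ 2 $ 2)"
    and "\<alpha> \<noteq> 0" and "\<beta> \<noteq> 0" and "\<gamma> \<noteq> 0" and "\<delta> \<noteq> 0"
    and "t = (\<beta> / \<alpha>)\<^sup>2" and "s = (\<gamma> / \<delta>)\<^sup>2"
  shows "fraction_measure B 1 1 =
           boolean_compression (1 / t) (s_free_conv (semicircle2 \<alpha> \<beta>) (semicircle2 \<delta> \<gamma>))
       \<and> fraction_measure B 2 2 =
           boolean_compression (1 / s) (s_free_conv (semicircle2 \<delta> \<gamma>) (semicircle2 \<alpha> \<beta>))
       \<and> fraction_measure B 1 2 = boolean_compression t (fraction_measure B 1 1)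
       \<and> fraction_measure B 2 1 = boolean_compression s (fraction_measure B 2 2)"
proof -
  have squares: "\<alpha>\<^sup>2 = B $ 1 $ 1" "\<beta>\<^sup>2 = B $ 1 $ 2" "\<gamma>\<^sup>2 = B $ 2 $ 1" "\<delta>\<^sup>2 = B $ 2 $ 2"
    using assms by simp_all
  have entries: "B $ 1 $ 1 \<noteq> 0" "B $ 1 $ 2 \<noteq> 0" "B $ 2 $ 1 \<noteq> 0" "B $ 2 $ 2 \<noteq> 0"
    using assms by auto
  have t: "t = B $ 1 $ 2 / B $ 1 $ 1" and s: "s = B $ 2 $ 1 / B $ 2 $ 2"
    using squares assms by (simp_all only: power_divide)
  have st0: "complex_of_real t \<noteq> 0" "complex_of_real s \<noteq> 0" using entries by (simp_all add: t s)
  let ?K = "K_fraction B"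
  note fm = fraction_measure_props[of B, OF nonneg]
  have row1: "?K 1 2 z = complex_of_real t * ?K 1 1 z" if "0 < Im z" for z
    unfolding t by (rule K_fraction_row_proportional[OF nonneg that entries(1)])
  have row2: "?K 2 1 z = complex_of_real s * ?K 2 2 z" if "0 < Im z" for z
    unfolding s by (rule K_fraction_row_proportional[OF nonneg that entries(4)])
  have A: "?K 1 2 z * (z - ?K 1 2 z / complex_of_real t - ?K 2 1 z) = complex_of_real (\<beta>\<^sup>2)" if z: "0 < Im z" for z
  proof -
    have "?K 1 2 z / complex_of_real t = ?K 1 1 z" using row1[OF z] st0 by simp
    then show ?thesis using K_fraction_mult_denominator[OF nonneg z, of 1 2] by (simp only: squares)
  qed
  have C: "?K 2 1 z * (z - ?K 1 2 z - ?K 2 1 z / complex_of_real s) = complex_of_real (\<gamma>\<^sup>2)" if z: "0 < Im z" for z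
  proof -
    have "?K 2 1 z / complex_of_real s = ?K 2 2 z" using row2[OF z] st0 by simp
    then show ?thesis using K_fraction_mult_denominator[OF nonneg z, of 2 1] by (simp only: squares)
  qed
  note \<sigma>1 = boolean_semicircle_semicircle2[OF assms(6,7), folded assms(10)]
  note \<sigma>2 = boolean_semicircle_semicircle2[OF assms(9,8), folded assms(11)]
  \<comment> \<open>The s-free convolution is the non-diagonal measure; the diagonal one arises only
    after compression by \<open>1 / t\<close>.\<close>
  have s12: "s_free_conv (semicircle2 \<alpha> \<beta>) (semicircle2 \<delta> \<gamma>) = fraction_measure B 1 2"
    by (rule s_free_conv_eqI[OF \<sigma>1 \<sigma>2 fm(1) fm(2) A C Im_K_fraction_le[OF nonneg]])
  have A': "?K 2 1 z * (z - ?K 2 1 z / complex_of_real s - ?K 1 2 z) = complex_of_real (\<gamma>\<^sup>2)" if "0 < Im z" for z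
    using C[OF that] by (simp add: algebra_simps)
  have C': "?K 1 2 z * (z - ?K 2 1 z - ?K 1 2 z / complex_of_real t) = complex_of_real (\<beta>\<^sup>2)" if "0 < Im z" for z
    using A[OF that] by (simp add: algebra_simps)
  have s21: "s_free_conv (semicircle2 \<delta> \<gamma>) (semicircle2 \<alpha> \<beta>) = fraction_measure B 2 1"
    by (rule s_free_conv_eqI[OF \<sigma>2 \<sigma>1 fm(1) fm(2) A' C' Im_K_fraction_le[OF nonneg]])
  have "boolean_compression (1 / t) (fraction_measure B 1 2) = fraction_measure B 1 1"
    "boolean_compression (1 / s) (fraction_measure B 2 1) = fraction_measure B 2 2"
    "boolean_compression t (fraction_measure B 1 1) = fraction_measure B 1 2"
    "boolean_compression s (fraction_measure B 2 2) = fraction_measure B 2 1"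
    by (rule boolean_compression_eqI[OF fm(1)], use fm(2) row1 row2 st0 in simp)+
  then show ?thesis unfolding s12 s21 by simp
qed

end
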